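(* Let $M_0\ge0$, $M_1\ge 0$, and let $(Q_n)_{n\ge0}$ be the monic orthogonal polynomials ($\deg Q_n=n$) with respect to the inner product $$(P,Q)=\int_{\mathbb{R}}P(x)Q(x)e^{-x^2}\,dx+M_0P(0)Q(0)+M_1P'(0)Q'(0).$$ Let $(\xi_{n,k})_{k=1}^{[n/2]}$ be the positive zeros of $Q_n$ in increasing order. Then the following limits hold as $n\to\infty$, for each fixed $k$ in the indicated range. (a) If $M_0=0$, then $2\sqrt n\,\xi_{2n,k}\to j_{-1/2,k}$ for $k\ge1$. If $M_0>0$, then $\sqrt n\,\xi_{2n,1}\to0$ and $2\sqrt n\,\xi_{2n,k}\to j_{3/2,k-1}$ for $k\ge2$. (b) If $M_1=0$, then $2\sqrt n\,\xi_{2n+1,k}\to j_{1/2,k}$ for $k\ge1$. If $M_1>0$, then $\sqrt n\,\xi_{2n+1,1}\to0$ and $2\sqrt n\,\xi_{2n+1,k}\to j_{5/2,k-1}$ for $k\ge2$.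
   Context: For $\alpha\in\mathbb{R}$, $J_\alpha$ is the Bessel function of the first kind, $J_\alpha(z)=\sum_{m=0}^\infty\frac{(-1)^m}{m!\,\Gamma(m+\alpha+1)}\left(\frac z2\right)^{2m+\alpha}$, and $(j_{\alpha,k})_{k\ge1}$ denotes its positive zeros in increasing order. It is known that all the zeros of $Q_n$ are real, simple and symmetric with respect to the origin, so $Q_n$ has exactly $[n/2]$ positive zeros, where $[\cdot]$ denotes the integer part. *)

theory Defs
  imports "HOL-Analysis.Analysis" "HOL-Computational_Algebra.Polynomial"
begin

(* J_alpha on the positive half-line, the only place where it is used (powr is not meaningful
   for a negative base).  rGamma is the reciprocal Gamma function, which vanishes at the
   poles of Gamma. *)
definition bessel_J :: "real \<Rightarrow> real \<Rightarrow> real" where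
  "bessel_J \<alpha> z =
     (\<Sum>m. (-1) ^ m / fact m * rGamma (real m + \<alpha> + 1) * (z / 2) powr (2 * real m + \<alpha>))"

(* The k-th smallest element, counting from k = 1, of a set that is finite or whose elements
   can be listed as an increasing unbounded sequence; unspecified if there is no such element. *)
definition kth_least :: "real set \<Rightarrow> nat \<Rightarrow> real" where
  "kth_least S k = (THE x. x \<in> S \<and> finite {y \<in> S. y \<le> x} \<and> card {y \<in> S. y \<le> x} = k)"

lemma kth_leastI:
  assumes "x \<in> S" "finite {y \<in> S. y \<le> x}" "card {y \<in> S. y \<le> x} = k"
  shows "kth_least S k = x"
  unfolding kth_least_def
proof (rule the_equality)
  fix u assume u: "u \<in> S \<and> finite {y \<in> S. y \<le> u} \<and> card {y \<in> S. y \<le> u} = k"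
  have less: False if "v < w" "w \<in> S" "finite {y \<in> S. y \<le> w}"
    "card {y \<in> S. y \<le> v} = card {y \<in> S. y \<le> w}" for v w
  proof -
    have "w \<in> {y \<in> S. y \<le> w}" "w \<notin> {y \<in> S. y \<le> v}" using that(1,2) by auto
    moreover have "{y \<in> S. y \<le> v} \<subseteq> {y \<in> S. y \<le> w}" using that(1) by auto
    ultimately have "{y \<in> S. y \<le> v} \<subset> {y \<in> S. y \<le> w}" by blast
    then show False by (metis less_irrefl psubset_card_mono that(3,4))
  qed
  consider "u < x" | "u = x" | "x < u" by linarith
  then show "u = x"
  proof cases
    case 1
    then show ?thesis using less[OF 1 assms(1,2)] u assms(3) by simp
  next
    case 3
    then show ?thesis using less[OF 3] u assms(3) by simp
  qed
qed (use assms in auto)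

lemma kth_least_range:
  assumes "strict_mono f"
  shows "kth_least (range f) (Suc k) = f k"
proof (rule kth_leastI)
  have eq: "{y \<in> range f. y \<le> f k} = f ` {..k}"
    using strict_mono_less_eq[OF assms] by auto
  show "finite {y \<in> range f. y \<le> f k}" unfolding eq by simp
  show "card {y \<in> range f. y \<le> f k} = Suc k"
    unfolding eq using inj_on_subset[OF strict_mono_imp_inj_on[OF assms] subset_UNIV, of "{..k}"]
    by (simp add: card_image)
qed simp

definition bessel_zero :: "real \<Rightarrow> nat \<Rightarrow> real" where
  "bessel_zero \<alpha> k = kth_least {x. x > 0 \<and> bessel_J \<alpha> x = 0} k"

definition positive_root :: "real poly \<Rightarrow> nat \<Rightarrow> real" where
  "positive_root p k = kth_least {x. x > 0 \<and> poly p x = 0} k"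

definition hermite_sobolev :: "real \<Rightarrow> real \<Rightarrow> real poly \<Rightarrow> real poly \<Rightarrow> real" where
  "hermite_sobolev M0 M1 P R =
     (\<integral>x. poly P x * poly R x * exp (- x\<^sup>2) \<partial>lborel)
       + M0 * poly P 0 * poly R 0 + M1 * poly (pderiv P) 0 * poly (pderiv R) 0"

definition monic_orthogonal ::
  "(real poly \<Rightarrow> real poly \<Rightarrow> real) \<Rightarrow> (nat \<Rightarrow> real poly) \<Rightarrow> bool" where
  "monic_orthogonal B Q \<longleftrightarrow>
     (\<forall>n. degree (Q n) = n \<and> lead_coeff (Q n) = 1) \<and> (\<forall>m n. m \<noteq> n \<longrightarrow> B (Q m) (Q n) = 0)"

end

theory Submission
  imports Defs "HOL-Probability.Distributions"
begin

text \<open>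
  Both parities are one problem in the variable \<open>t = x\<^sup>2\<close>. For \<open>e \<in> {0, 1}\<close> the polynomial
  \<open>Q (2 n + e)\<close> equals \<open>x\<^sup>e R (x\<^sup>2)\<close>, where \<open>R\<close> is orthogonal on the half-line with respect to
  \<open>t\<^sup>\<alpha> e\<^sup>-\<^sup>t dt\<close>, \<open>\<alpha> = e - 1/2\<close>, plus a point mass \<open>M\<close> at the origin: an even polynomial sees only
  \<open>M0\<close>, an odd one only \<open>M1\<close>. With \<open>a = \<alpha> + 1\<close> and both Laguerre polynomials normalised to have
  value 1 at 0, one has up to a factor
  \<open>R(t) = L_n^(\<alpha>)(t) - \<theta>_n L_{n-1}^(\<alpha>+1)(t)\<close>,
  because \<open>L_{n-1}^(\<alpha>+1)\<close> is orthogonal to \<open>t, \<dots>, t\<^sup>n\<^sup>-\<^sup>1\<close> for the weight \<open>t\<^sup>\<alpha> e\<^sup>-\<^sup>t\<close>, so that the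
  single remaining condition, orthogonality to 1, fixes \<open>\<theta>_n\<close>
  (\<open>sobolev_polynomial_eq\<close>). The integral of \<open>L_{n-1}^(\<alpha>+1)\<close> against the weight
  tends to 0, whence \<open>\<theta>_n\<close> tends to 1 as soon as \<open>M > 0\<close>, however small the mass is, while \<open>\<theta>_n = 0\<close> for \<open>M = 0\<close>.

  Write \<open>B_a(t) = \<Sum> (-1)\<^sup>m t\<^sup>m / (m! (a)_m)\<close>, so that \<open>J_\<alpha> x\<close> is a nonvanishing factor times
  \<open>B_a (x\<^sup>2 / 4)\<close> on the positive half-line. The coefficients of \<open>R (t / n)\<close> are dominated by
  \<open>C / m!\<close> and converge, so \<open>R (t / n)\<close> and its derivative converge uniformly on bounded intervals.
  Without mass the limit is \<open>B_a\<close>. With mass it is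
  \<open>B_a - B_{a+1} = - t / (a (a + 1)) B_{a+2}\<close>: the parameter jumps by 2, and one zero is absorbed by
  the origin. Convergence together with the derivative carries simple zeros to simple zeros
  (\<open>kth_zero_tendsto\<close>), and \<open>R 0 = 1 - \<theta>_n > 0\<close> while the limit decreases at the origin, so the
  absorbed zero approaches it from the right and still counts as the first positive zero. A zero
  \<open>t\<close> of \<open>R (t / n)\<close> is the zero \<open>\<xi> = \<surd>(t / n)\<close> of \<open>Q\<close>, and a zero \<open>t\<close> of \<open>B_a\<close> is the zero
  \<open>2 \<surd>t\<close> of \<open>J_\<alpha>\<close>, which gives the factor \<open>2 \<surd>n\<close>.

  That the limit has infinitely many zeros, all simple, follows from contiguous relations: a common
  zero of \<open>B_a\<close> and its derivative would be a zero of every \<open>B_{a+k}\<close>, yet \<open>B_{a+k} \<longlonglongrightarrow> 1\<close>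
  (\<open>bessel_series_no_common_zero\<close>); and \<open>B_{1/2}(x\<^sup>2/4) = cos x\<close>, from which Rolle's theorem supplies zeros
  for \<open>a = 3/2, 5/2, \<dots>\<close> (\<open>bessel_series_zeros_unbounded\<close>).
\<close>

section \<open>Zeros in increasing order\<close>

text \<open>
  The relational form of \<open>kth_least\<close>: it also records that the element exists, which the definite
  description alone does not.
\<close>

definition is_kth :: "real set \<Rightarrow> nat \<Rightarrow> real \<Rightarrow> bool" where
  "is_kth S k x \<longleftrightarrow> x \<in> S \<and> finite {y \<in> S. y \<le> x} \<and> card {y \<in> S. y \<le> x} = k"

lemma kth_least_eq: "is_kth S k x \<Longrightarrow> kth_least S k = x"
  unfolding is_kth_def by (blast intro: kth_leastI)

text \<open>
  Changes of variable such as \<open>x = \<surd>(t / n)\<close> are increasing, so they move the zeros without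
  renumbering them.
\<close>

lemma is_kth_image:
  assumes "is_kth S k x" and "strict_mono_on S h"
  shows "is_kth (h ` S) k (h x)"
proof -
  have x: "x \<in> S" using assms(1) by (simp add: is_kth_def)
  have le: "h y \<le> h x \<longleftrightarrow> y \<le> x" if "y \<in> S" for y
    using strict_mono_on_less_eq[OF assms(2) that x] .
  have eq: "{y \<in> h ` S. y \<le> h x} = h ` {y \<in> S. y \<le> x}"
    using le by blast
  have "inj_on h {y \<in> S. y \<le> x}"
    using strict_mono_on_imp_inj_on[OF assms(2)] by (rule inj_on_subset) auto
  then show ?thesis
    using assms(1) unfolding is_kth_def eq by (simp add: card_image)
qed

lemma is_kth_exists:
  assumes fin: "\<And>u. finite {y \<in> S. y \<le> u}" and unb: "\<And>u. \<exists>y\<in>S. u < y"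
  shows "\<exists>x. is_kth S (Suc k) x"
proof -
  have next_el: "\<exists>x. is_kth S (Suc (card {y \<in> S. y \<le> u})) x" for u
  proof -
    obtain w where w: "w \<in> S" "u < w" using unb by blast
    let ?A = "{y \<in> S. y \<le> w} \<inter> {u<..}"
    have A: "finite ?A" "?A \<noteq> {}" using fin w by auto
    define x where "x = Min ?A"
    have x: "x \<in> ?A" unfolding x_def by (rule Min_in[OF A])
    have le: "x \<le> y" if "y \<in> ?A" for y unfolding x_def using Min_le[OF A(1) that] .
    have "{y \<in> S. y \<le> x} = insert x {y \<in> S. y \<le> u}"
    proof (intro equalityI subsetI)
      fix y assume "y \<in> {y \<in> S. y \<le> x}"
      then show "y \<in> insert x {y \<in> S. y \<le> u}" using le[of y] x by fastforce
    qed (use x in auto)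
    moreover have "x \<notin> {y \<in> S. y \<le> u}" "x \<in> S" using x by auto
    ultimately have "is_kth S (Suc (card {y \<in> S. y \<le> u})) x"
      unfolding is_kth_def using fin[of u] by simp
    then show ?thesis by blast
  qed
  show ?thesis
  proof (induction k)
    case 0
    obtain w where w: "w \<in> S" using unb by blast
    define u where "u = Min {y \<in> S. y \<le> w} - 1"
    have "{y \<in> S. y \<le> u} = {}"
    proof -
      have "u < y" if "y \<in> S" "y \<le> w" for y
        using Min_le[OF fin[of w], of y] that unfolding u_def by auto
      moreover have "u < w" using calculation[OF w] by simp
      ultimately show ?thesis by fastforce
    qed
    then have "card {y \<in> S. y \<le> u} = 0" by (metis card.empty)
    then show ?case using next_el[of u] by simp
  next
    case (Suc k)
    then obtain u where u: "is_kth S (Suc k) u" by blast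
    then show ?case using next_el[of u] unfolding is_kth_def[of S "Suc k" u] by simp
  qed
qed

section \<open>Convergence of simple zeros\<close>

text \<open>
  By compactness \<open>f\<close> keeps a positive distance from 0.
\<close>

lemma uniform_limit_eventually_nonzero:
  fixes f :: "real \<Rightarrow> real" and F :: "nat \<Rightarrow> real \<Rightarrow> real"
  assumes "uniform_limit {u..v} F f sequentially" "continuous_on {u..v} f"
    and "\<And>t. t \<in> {u..v} \<Longrightarrow> f t \<noteq> 0"
  shows "\<forall>\<^sub>F n in sequentially. \<forall>t\<in>{u..v}. F n t \<noteq> 0"
proof (cases "u \<le> v")
  case True
  have "continuous_on {u..v} (\<lambda>t. \<bar>f t\<bar>)" using assms(2) by (intro continuous_intros)
  then obtain x where x: "x \<in> {u..v}" "\<And>t. t \<in> {u..v} \<Longrightarrow> \<bar>f x\<bar> \<le> \<bar>f t\<bar>"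
    using continuous_attains_inf[of "{u..v}" "\<lambda>t. \<bar>f t\<bar>"] True by auto
  have "\<bar>f x\<bar> > 0" using assms(3) x(1) by simp
  from uniform_limitD[OF assms(1) this] show ?thesis
    by (rule eventually_mono) (use x(2) in \<open>force simp: dist_real_def\<close>)
qed simp

text \<open>
  Existence comes from the sign change; uniqueness from Rolle's theorem, since the derivative of
  \<open>F n\<close> inherits the nonvanishing of \<open>f'\<close>. The sign change is required of \<open>F n\<close> rather than of the
  limit because the latter may vanish at \<open>u\<close>, as it does at the origin.
\<close>

lemma eventually_unique_zero:
  fixes f' :: "real \<Rightarrow> real" and F F' :: "nat \<Rightarrow> real \<Rightarrow> real"
  assumes "u < v" and der: "\<And>n t. (F n has_real_derivative F' n t) (at t)"
    and "uniform_limit {u..v} F' f' sequentially" "continuous_on {u..v} f'"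
    and "\<And>t. t \<in> {u..v} \<Longrightarrow> f' t \<noteq> 0"
    and sgn: "\<forall>\<^sub>F n in sequentially. F n u * F n v < 0"
  shows "\<forall>\<^sub>F n in sequentially. \<exists>z. {t. u < t \<and> t \<le> v \<and> F n t = 0} = {z}"
proof -
  have "\<forall>\<^sub>F n in sequentially. \<forall>t\<in>{u..v}. F' n t \<noteq> 0"
    using assms(3-5) by (rule uniform_limit_eventually_nonzero)
  then show ?thesis using sgn
  proof eventually_elim
    case (elim n)
    have cont: "continuous_on {u..v} (F n)"
      using der DERIV_isCont by (intro continuous_at_imp_continuous_on) blast
    have "\<exists>z. u \<le> z \<and> z \<le> v \<and> F n z = 0"
    proof (cases "F n u < 0")
      case True
      then have "F n v > 0" using elim(2) by (simp add: mult_less_0_iff)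
      then show ?thesis using IVT'[of "F n" u 0 v] cont True \<open>u < v\<close> by auto
    next
      case False
      then have "F n v < 0" "F n u > 0" using elim(2) by (auto simp: mult_less_0_iff)
      then show ?thesis using IVT2'[of "F n" v 0 u] cont \<open>u < v\<close> by auto
    qed
    then obtain z where z: "u \<le> z" "z \<le> v" "F n z = 0" by blast
    have "u \<noteq> z" using z elim(2) by auto
    have False if xy: "x < y" "u \<le> x" "y \<le> v" "F n x = 0" "F n y = 0" for x y
    proof -
      obtain w where "x < w" "w < y" "F n y - F n x = (y - x) * F' n w"
        using MVT2[OF xy(1), of "F n" "F' n"] der by blast
      then show False using xy elim(1) by (auto dest: bspec[of _ _ w])
    qed
    then have "t = z" if "u < t" "t \<le> v" "F n t = 0" for t
      using that z by (cases t z rule: linorder_cases) (meson less_imp_le)+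
    then have "{t. u < t \<and> t \<le> v \<and> F n t = 0} = {z}" using z \<open>u \<noteq> z\<close> by auto
    then show ?case by blast
  qed
qed

text \<open>
  Multiplying by \<open>f' s\<close> treats increasing and decreasing zeros alike.
\<close>

lemma sign_change_at_simple_zero:
  fixes f f' :: "real \<Rightarrow> real"
  assumes der: "\<And>t. (f has_real_derivative f' t) (at t)" and cont: "isCont f' s"
    and "f s = 0" "f' s \<noteq> 0" "e > 0"
  shows "\<exists>d>0. d \<le> e \<and> (\<forall>t. \<bar>t - s\<bar> \<le> d \<longrightarrow> f' s * f' t > 0) \<and>
    (\<forall>t. s < t \<longrightarrow> t \<le> s + d \<longrightarrow> f' s * f t > 0) \<and>
    (\<forall>t. t < s \<longrightarrow> s - d \<le> t \<longrightarrow> f' s * f t < 0)"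
proof -
  have "((\<lambda>t. f' s * f' t) \<longlongrightarrow> f' s * f' s) (at s)"
    using cont unfolding isCont_def by (intro tendsto_intros)
  moreover have pos: "f' s * f' s > 0" using assms(4) by (auto simp: zero_less_mult_iff)
  ultimately have "\<forall>\<^sub>F t in at s. f' s * f' t > 0" by (rule order_tendstoD)
  then obtain d0 where d0: "d0 > 0" "\<And>t. t \<noteq> s \<Longrightarrow> dist t s < d0 \<Longrightarrow> f' s * f' t > 0"
    unfolding eventually_at by auto
  define d where "d = min (d0 / 2) e"
  have d: "d > 0" "d \<le> e" "d < d0" using d0 assms(5) by (auto simp: d_def)
  have 1: "f' s * f' t > 0" if "\<bar>t - s\<bar> \<le> d" for t
    using d0(2)[of t] that d pos by (cases "t = s") (auto simp: dist_real_def)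
  have 2: "f' s * f t > 0" if t: "s < t" "t \<le> s + d" for t
  proof -
    obtain w where w: "s < w" "w < t" "f t - f s = (t - s) * f' w"
      using MVT2[OF t(1), of f f'] der by blast
    then have eq: "f' s * f t = (t - s) * (f' s * f' w)" using assms(3) by simp
    have "(t - s) * (f' s * f' w) > 0"
      by (rule mult_pos_pos) (use 1[of w] w(1,2) t in auto)
    then show ?thesis unfolding eq .
  qed
  have 3: "f' s * f t < 0" if t: "t < s" "s - d \<le> t" for t
  proof -
    obtain w where w: "t < w" "w < s" "f s - f t = (s - t) * f' w"
      using MVT2[OF t(1), of f f'] der by blast
    then have "f t = - ((s - t) * f' w)" using assms(3) by linarith
    then have eq: "f' s * f t = - ((s - t) * (f' s * f' w))" by simp
    have "(s - t) * (f' s * f' w) > 0"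
      by (rule mult_pos_pos) (use 1[of w] w(1,2) t in auto)
    then show ?thesis unfolding eq by simp
  qed
  show ?thesis using d(1,2) 1 2 3 by blast
qed

text \<open>
  Simple zeros are isolated, hence cannot accumulate in a compact interval.
\<close>

lemma finite_simple_zeros:
  fixes f f' :: "real \<Rightarrow> real"
  assumes der: "\<And>t. (f has_real_derivative f' t) (at t)"
    and cont: "continuous_on UNIV f'"
    and simple: "\<And>t. 0 \<le> t \<Longrightarrow> f t = 0 \<Longrightarrow> f' t \<noteq> 0"
  shows "finite {t. 0 \<le> t \<and> t \<le> u \<and> f t = 0}"
proof -
  have "\<not> s islimpt {t. f t = 0}" if s: "s \<in> {0..u}" for s
  proof (cases "f s = 0")
    case True
    have "isCont f' s" "f' s \<noteq> 0"
      using cont simple s True by (auto simp: continuous_on_eq_continuous_at)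
    then obtain d where d: "d > 0" "d \<le> 1"
    "\<And>t. \<bar>t - s\<bar> \<le> d \<Longrightarrow> f' s * f' t > 0"
    "\<And>t. s < t \<Longrightarrow> t \<le> s + d \<Longrightarrow> f' s * f t > 0"
    "\<And>t. t < s \<Longrightarrow> s - d \<le> t \<Longrightarrow> f' s * f t < 0"
      using sign_change_at_simple_zero[OF der _ True _ zero_less_one] by blast
    have "f t \<noteq> 0" if "t \<noteq> s" "dist t s < d" for t
    proof (cases "s < t")
      case True then show ?thesis using d(4)[of t] that by (auto simp: dist_real_def)
    next
      case False then show ?thesis using d(5)[of t] that by (auto simp: dist_real_def)
    qed
    then show ?thesis using d(1) unfolding islimpt_approachable by auto
  next
    case False
    have "isCont f s" using der DERIV_isCont by blast
    then have "\<forall>\<^sub>F t in at s. f t \<noteq> 0" unfolding isCont_def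
      using False by (rule tendsto_imp_eventually_ne)
    then show ?thesis unfolding islimpt_iff_eventually by simp
  qed
  then have "finite ({0..u} \<inter> {t. f t = 0})"
    by (intro finite_not_islimpt_in_compact) auto
  then show ?thesis by (rule finite_subset[rotated]) auto
qed

text \<open>
  The hypotheses under which the positive zeros of \<open>F n\<close> converge to the nonnegative zeros of \<open>f\<close>. If
  the limit vanishes at 0, the zero of \<open>F n\<close> nearby could be on either side; \<open>origin\<close> prescribes the
  sign of \<open>F n 0\<close> that forces it to be positive.
\<close>

locale zero_convergence =
  fixes f f' :: "real \<Rightarrow> real" and F F' :: "nat \<Rightarrow> real \<Rightarrow> real"
  assumes der_F: "(F n has_real_derivative F' n t) (at t)"
    and der_f: "(f has_real_derivative f' t) (at t)"
    and cont_f': "continuous_on UNIV f'"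
    and lim_F: "uniform_limit {0..T} F f sequentially"
    and lim_F': "uniform_limit {0..T} F' f' sequentially"
    and simple: "0 \<le> t \<Longrightarrow> f t = 0 \<Longrightarrow> f' t \<noteq> 0"
    and origin: "f 0 = 0 \<Longrightarrow> \<forall>\<^sub>F n in sequentially. f' 0 * F n 0 < 0"
begin

abbreviation zeros :: "real \<Rightarrow> real set" where
  "zeros u \<equiv> {t. 0 \<le> t \<and> t \<le> u \<and> f t = 0}"

abbreviation zeros_F :: "nat \<Rightarrow> real \<Rightarrow> real set" where
  "zeros_F n u \<equiv> {t. 0 < t \<and> t \<le> u \<and> F n t = 0}"

lemma finite_zeros: "finite (zeros u)"
  using finite_simple_zeros[OF der_f cont_f' simple] .

lemma tendsto_F: "0 \<le> t \<Longrightarrow> (\<lambda>n. F n t) \<longlonglongrightarrow> f t"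
  using tendsto_uniform_limitI[OF lim_F[of t]] by simp

lemma cont_f: "continuous_on A f"
  using der_f DERIV_isCont by (intro continuous_at_imp_continuous_on) blast

text \<open>
  Induction on the number of zeros of \<open>f\<close> up to \<open>u\<close>. The largest of them, \<open>s\<close>, is enclosed in an interval
  \<open>{w..v}\<close> in which \<open>F n\<close> has exactly one zero; to the left of \<open>w\<close> the induction hypothesis applies,
  and between \<open>v\<close> and \<open>u\<close> there is no zero. If \<open>s = 0\<close>, the interval starts at \<open>w = 0\<close>.
\<close>

lemma eventually_card_zeros:
  assumes "0 \<le> u" "f u \<noteq> 0"
  shows "\<forall>\<^sub>F n in sequentially. finite (zeros_F n u) \<and> card (zeros_F n u) = card (zeros u)"
  using assms
proof (induction "card (zeros u)" arbitrary: u)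
  case 0
  then have "zeros u = {}" using finite_zeros by simp
  then have "\<forall>\<^sub>F n in sequentially. \<forall>t\<in>{0..u}. F n t \<noteq> 0"
    by (intro uniform_limit_eventually_nonzero[OF lim_F cont_f]) auto
  then show ?case
  proof eventually_elim
    case (elim n)
    then have "zeros_F n u = {}" by force
    then show ?case unfolding \<open>zeros u = {}\<close> by (metis card.empty finite.emptyI)
  qed
next
  case (Suc k)
  have ne: "zeros u \<noteq> {}" using Suc.hyps(2) by force
  define s where "s = Max (zeros u)"
  have s: "s \<in> zeros u" unfolding s_def using Max_in[OF finite_zeros ne] .
  have s_max: "t \<le> s" if "t \<in> zeros u" for t
    unfolding s_def using Max_ge[OF finite_zeros that] .
  have "s < u" using s Suc.prems by (cases "s = u") auto
  have f's: "f' s \<noteq> 0" using simple s by auto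
  have "isCont f' s" using cont_f' by (simp add: continuous_on_eq_continuous_at)
  then obtain d where d: "d > 0" "d \<le> 1"
    "\<And>t. \<bar>t - s\<bar> \<le> d \<Longrightarrow> f' s * f' t > 0"
    "\<And>t. s < t \<Longrightarrow> t \<le> s + d \<Longrightarrow> f' s * f t > 0"
    "\<And>t. t < s \<Longrightarrow> s - d \<le> t \<Longrightarrow> f' s * f t < 0"
    using sign_change_at_simple_zero[OF der_f _ _ f's zero_less_one] s by blast
  define v where "v = min u (s + d)"
  define w where "w = max 0 (s - d)"
  have v: "s < v" "v \<le> u" "v \<le> s + d" using d(1) \<open>s < u\<close> by (auto simp: v_def)
  have w: "0 \<le> w" "w \<le> s" "s - d \<le> w" "s > 0 \<Longrightarrow> w < s" using d(1) s by (auto simp: w_def)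
  have right: "\<forall>\<^sub>F n in sequentially. \<forall>t\<in>{v..u}. F n t \<noteq> 0"
  proof (intro uniform_limit_eventually_nonzero[OF _ cont_f])
    show "uniform_limit {v..u} F f sequentially"
      using lim_F[of u] by (rule uniform_limit_on_subset) (use v s in auto)
    fix t assume "t \<in> {v..u}" then show "f t \<noteq> 0" using s_max[of t] v s by auto
  qed
  have mid: "\<forall>\<^sub>F n in sequentially. \<exists>z. {t. w < t \<and> t \<le> v \<and> F n t = 0} = {z}"
  proof (rule eventually_unique_zero[OF _ der_F])
    show "uniform_limit {w..v} F' f' sequentially"
      using lim_F'[of v] by (rule uniform_limit_on_subset) (use w in auto)
    show "continuous_on {w..v} f'" using cont_f' by (rule continuous_on_subset) simp
    show "w < v" using v w by simp
    show "f' t \<noteq> 0" if "t \<in> {w..v}" for t using d(3)[of t] that v w by force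
    have "(\<lambda>n. f' s * F n v) \<longlonglongrightarrow> f' s * f v"
      using v s by (intro tendsto_intros tendsto_F) simp
    then have evv: "\<forall>\<^sub>F n in sequentially. f' s * F n v > 0"
      by (rule order_tendstoD) (use d(4)[of v] v in simp)
    have evw: "\<forall>\<^sub>F n in sequentially. f' s * F n w < 0"
    proof (cases "s = 0")
      case True
      then show ?thesis using origin s w by auto
    next
      case False
      have "(\<lambda>n. f' s * F n w) \<longlonglongrightarrow> f' s * f w"
        using w by (intro tendsto_intros tendsto_F) simp
      then show ?thesis
        by (rule order_tendstoD) (use d(5)[of w] w False s in simp)
    qed
    show "\<forall>\<^sub>F n in sequentially. F n w * F n v < 0"
      using evv evw
      by eventually_elim (auto simp: mult_less_0_iff zero_less_mult_iff)
  qed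
  have left: "\<forall>\<^sub>F n in sequentially. finite (zeros_F n w) \<and> card (zeros_F n w) = k"
  proof (cases "s = 0")
    case True
    then have "zeros u = {0}" using s s_max by force
    then have "k = 0" using Suc.hyps(2) by simp
    have "finite (zeros_F n w) \<and> card (zeros_F n w) = k" for n
    proof -
      have eq: "zeros_F n w = {}" using True w by auto
      show ?thesis unfolding eq using \<open>k = 0\<close> by simp
    qed
    then show ?thesis by simp
  next
    case False
    then have "w < s" using w s by simp
    have nz: "f t \<noteq> 0" if "w \<le> t" "t < s" for t
      using d(5)[of t] that w by auto
    have "zeros u = insert s (zeros w)"
    proof (intro equalityI subsetI)
      fix t assume t: "t \<in> zeros u"
      then show "t \<in> insert s (zeros w)" using s_max[OF t] nz[of t] by force
    qed (use s \<open>w < s\<close> in auto)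
    moreover have "s \<notin> zeros w" using \<open>w < s\<close> by simp
    ultimately have "k = card (zeros w)" using Suc.hyps(2) finite_zeros by simp
    then show ?thesis using Suc.hyps(1)[of w] w nz[of w] \<open>w < s\<close> by simp
  qed
  show ?case using left mid right
  proof eventually_elim
    case (elim n)
    then obtain z where z: "{t. w < t \<and> t \<le> v \<and> F n t = 0} = {z}" by blast
    then have zz: "w < z" "z \<le> v" "F n z = 0" by auto
    have "zeros_F n u = insert z (zeros_F n w)"
    proof (intro equalityI subsetI)
      fix t assume t: "t \<in> zeros_F n u"
      show "t \<in> insert z (zeros_F n w)"
      proof (cases "w < t \<and> t \<le> v")
        case True then show ?thesis using z t by auto
      next
        case False then show ?thesis using t elim(3) by force
      qed
    next
      fix t assume "t \<in> insert z (zeros_F n w)"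
      then show "t \<in> zeros_F n u" using zz w v by auto
    qed
    moreover have "z \<notin> zeros_F n w" using zz by simp
    ultimately show ?case using elim(1) Suc.hyps(2) by simp
  qed
qed

text \<open>
  For small \<open>d > 0\<close>, \<open>F n\<close> eventually has \<open>k\<close> positive zeros up to \<open>s + d\<close> but fewer up to \<open>s - d\<close>,
  so the \<open>k\<close>-th one is between.
\<close>

theorem kth_zero_tendsto:
  assumes kth: "is_kth {t. 0 \<le> t \<and> f t = 0} k s"
  shows "(\<lambda>n. kth_least {t. 0 < t \<and> F n t = 0} k) \<longlonglongrightarrow> s"
    and "\<forall>\<^sub>F n in sequentially. \<exists>z. is_kth {t. 0 < t \<and> F n t = 0} k z"
proof -
  have zeros_eq: "{y \<in> {t. 0 \<le> t \<and> f t = 0}. y \<le> u} = zeros u"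
    "{y \<in> {t. 0 < t \<and> F n t = 0}. y \<le> u} = zeros_F n u" for u n by auto
  have s: "0 \<le> s" "f s = 0" "card (zeros s) = k"
    using kth unfolding is_kth_def zeros_eq by auto
  have close: "\<forall>\<^sub>F n in sequentially. \<exists>z. is_kth {t. 0 < t \<and> F n t = 0} k z \<and> \<bar>z - s\<bar> \<le> e"
    if e: "e > 0" for e
  proof -
    have f's: "f' s \<noteq> 0" using simple s by auto
    have "isCont f' s" using cont_f' by (simp add: continuous_on_eq_continuous_at)
    then obtain d where d: "d > 0" "d \<le> e"
    "\<And>t. \<bar>t - s\<bar> \<le> d \<Longrightarrow> f' s * f' t > 0"
    "\<And>t. s < t \<Longrightarrow> t \<le> s + d \<Longrightarrow> f' s * f t > 0"
    "\<And>t. t < s \<Longrightarrow> s - d \<le> t \<Longrightarrow> f' s * f t < 0"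
      using sign_change_at_simple_zero[OF der_f _ s(2) f's e] by blast
    define v where "v = s + d"
    define w where "w = max 0 (s - d)"
    have above: "\<forall>\<^sub>F n in sequentially. finite (zeros_F n v) \<and> card (zeros_F n v) = k"
    proof -
      have "f t \<noteq> 0" if "s < t" "t \<le> v" for t
        using d(4)[of t] that unfolding v_def by auto
      then have "zeros v = zeros s" using s(1) d(1) unfolding v_def by force
      moreover have "0 \<le> v" "f v \<noteq> 0" using d(4)[of v] d(1) s by (auto simp: v_def)
      ultimately show ?thesis using eventually_card_zeros[of v] s(3) by simp
    qed
    have below: "\<forall>\<^sub>F n in sequentially. finite (zeros_F n w) \<and> card (zeros_F n w) < k"
    proof (cases "s = 0")
      case True
      then have "zeros s = {0}" using s by auto
      then have "k = 1" using s by simp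
      have "finite (zeros_F n w) \<and> card (zeros_F n w) < k" for n
      proof -
        have eq: "zeros_F n w = {}" using True d by (auto simp: w_def)
        show ?thesis unfolding eq using \<open>k = 1\<close> by simp
      qed
      then show ?thesis by simp
    next
      case False
      then have w: "0 \<le> w" "w < s" "s - d \<le> w" using s d by (auto simp: w_def)
      have "zeros w \<subseteq> zeros s" "s \<in> zeros s" "s \<notin> zeros w" using w s by auto
      then have "zeros w \<subset> zeros s" by blast
      then have less: "card (zeros w) < k"
        using psubset_card_mono[OF finite_zeros[of s], of "zeros w"] s(3) by simp
      have "f w \<noteq> 0" using d(5)[of w] w by auto
      from eventually_card_zeros[OF w(1) this] show ?thesis
        by (rule eventually_mono) (use less in linarith)
    qed
    show ?thesis using above below
    proof eventually_elim
      case (elim n)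
      then have fin: "finite (zeros_F n v)" and ne: "zeros_F n v \<noteq> {}" by force+
      define z where "z = Max (zeros_F n v)"
      have z: "z \<in> zeros_F n v" unfolding z_def using Max_in[OF fin ne] .
      have z_max: "t \<le> z" if "t \<in> zeros_F n v" for t
        unfolding z_def using Max_ge[OF fin that] .
      have "zeros_F n z = zeros_F n v"
      proof (intro equalityI subsetI)
        fix t assume "t \<in> zeros_F n v"
        then show "t \<in> zeros_F n z" using z_max[of t] by simp
      qed (use z in auto)
      then have "is_kth {t. 0 < t \<and> F n t = 0} k z"
        unfolding is_kth_def zeros_eq using z elim by auto
      moreover have "w < z"
      proof (rule ccontr)
        assume "\<not> w < z"
        have "zeros_F n v \<subseteq> zeros_F n w"
        proof
          fix t assume "t \<in> zeros_F n v"
          then show "t \<in> zeros_F n w" using z_max[of t] \<open>\<not> w < z\<close> by simp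
        qed
        then show False using card_mono[of "zeros_F n w" "zeros_F n v"] elim by simp
      qed
      ultimately show ?case using z d unfolding v_def w_def by (intro exI[of _ z]) auto
    qed
  qed
  show "\<forall>\<^sub>F n in sequentially. \<exists>z. is_kth {t. 0 < t \<and> F n t = 0} k z"
    using close[of 1] by (auto elim: eventually_mono)
  show "(\<lambda>n. kth_least {t. 0 < t \<and> F n t = 0} k) \<longlonglongrightarrow> s"
  proof (rule tendstoI)
    fix e :: real assume "e > 0"
    then show "\<forall>\<^sub>F n in sequentially. dist (kth_least {t. 0 < t \<and> F n t = 0} k) s < e"
      using close[of "e / 2"] by (auto elim!: eventually_mono simp: kth_least_eq dist_real_def)
  qed
qed

end

section \<open>Locally uniform convergence of power series\<close>

lemma summable_exp_bounded:
  fixes c :: "nat \<Rightarrow> real"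
  assumes "\<And>m. \<bar>c m\<bar> \<le> C / fact m"
  shows "summable (\<lambda>m. c m * t ^ m)"
proof (rule summable_comparison_test')
  show "summable (\<lambda>m. C * (inverse (fact m) * \<bar>t\<bar> ^ m))"
    by (intro summable_mult summable_exp)
  fix m :: nat
  have "\<bar>c m\<bar> * \<bar>t\<bar> ^ m \<le> C / fact m * \<bar>t\<bar> ^ m"
    by (intro mult_right_mono assms) simp
  then show "norm (c m * t ^ m) \<le> C * (inverse (fact m) * \<bar>t\<bar> ^ m)"
    by (simp add: abs_mult power_abs field_simps)
qed

lemma limit_exp_bounded:
  fixes c :: "nat \<Rightarrow> nat \<Rightarrow> real"
  assumes "\<And>n m. \<bar>c n m\<bar> \<le> C / fact m" and "\<And>m. (\<lambda>n. c n m) \<longlonglongrightarrow> d m"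
  shows "\<bar>d m\<bar> \<le> C / fact m"
proof (rule LIMSEQ_le_const2)
  show "(\<lambda>n. \<bar>c n m\<bar>) \<longlonglongrightarrow> \<bar>d m\<bar>" by (intro tendsto_intros assms)
qed (use assms(1) in blast)

text \<open>
  Tannery's theorem applied to the sum of \<open>\<bar>c n m - d m\<bar> T\<^sup>m\<close>, which bounds the difference of the two series on
  the whole interval.
\<close>

lemma uniform_limit_powser:
  fixes c :: "nat \<Rightarrow> nat \<Rightarrow> real"
  assumes bound: "\<And>n m. \<bar>c n m\<bar> \<le> C / fact m" and lim: "\<And>m. (\<lambda>n. c n m) \<longlonglongrightarrow> d m"
  shows "uniform_limit {0..T} (\<lambda>n t. \<Sum>m. c n m * t ^ m) (\<lambda>t. \<Sum>m. d m * t ^ m) sequentially"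
proof -
  note bound_d = limit_exp_bounded[OF bound lim]
  have bound_diff: "\<bar>\<bar>c n m - d m\<bar>\<bar> \<le> (2 * C) / fact m" for n m
    using bound[of n m] bound_d[of m] by (simp add: abs_diff_le_iff) linarith
  have term_bound: "\<bar>\<bar>c n m - d m\<bar> * \<bar>T\<bar> ^ m\<bar> \<le> 2 * C * (inverse (fact m) * \<bar>T\<bar> ^ m)" for n m
  proof -
    have "\<bar>c n m - d m\<bar> * \<bar>T\<bar> ^ m \<le> 2 * C / fact m * \<bar>T\<bar> ^ m"
      using bound_diff by (intro mult_right_mono) auto
    then show ?thesis by (simp add: abs_mult field_simps)
  qed
  have "(\<lambda>n. \<Sum>m. \<bar>c n m - d m\<bar> * \<bar>T\<bar> ^ m) \<longlonglongrightarrow> (\<Sum>m. 0)"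
  proof (rule tannerys_theorem[THEN conjunct2, THEN conjunct2])
    show "(\<lambda>n. \<bar>c n m - d m\<bar> * \<bar>T\<bar> ^ m) \<longlonglongrightarrow> 0" for m
      using lim[of m] by (intro tendsto_mult_left_zero) (simp add: LIM_zero tendsto_rabs_zero)
    show "\<forall>\<^sub>F (m, n) in at_top \<times>\<^sub>F sequentially.
        norm (\<bar>c n m - d m\<bar> * \<bar>T\<bar> ^ m) \<le> 2 * C * (inverse (fact m) * \<bar>T\<bar> ^ m)"
      using term_bound by (intro always_eventually) auto
    show "summable (\<lambda>m. 2 * C * (inverse (fact m) * \<bar>T\<bar> ^ m))"
      by (intro summable_mult summable_exp)
  qed simp
  then have sup: "(\<lambda>n. \<Sum>m. \<bar>c n m - d m\<bar> * \<bar>T\<bar> ^ m) \<longlonglongrightarrow> 0" by simp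
  have le: "dist (\<Sum>m. c n m * t ^ m) (\<Sum>m. d m * t ^ m) \<le> (\<Sum>m. \<bar>c n m - d m\<bar> * \<bar>T\<bar> ^ m)"
    if t: "t \<in> {0..T}" for n t
  proof -
    have s: "summable (\<lambda>m. \<bar>c n m - d m\<bar> * T ^ m)" "summable (\<lambda>m. \<bar>c n m - d m\<bar> * t ^ m)"
      by (rule summable_exp_bounded, rule bound_diff)+
    have "(\<Sum>m. c n m * t ^ m) - (\<Sum>m. d m * t ^ m) = (\<Sum>m. (c n m - d m) * t ^ m)"
      using suminf_diff[OF summable_exp_bounded[of "c n" C, OF bound] summable_exp_bounded[of d C, OF bound_d]]
      by (simp add: left_diff_distrib)
    moreover have abs_eq: "\<bar>(c n m - d m) * t ^ m\<bar> = \<bar>c n m - d m\<bar> * t ^ m" for m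
      using t by (simp add: abs_mult)
    have "\<bar>\<Sum>m. (c n m - d m) * t ^ m\<bar> \<le> (\<Sum>m. \<bar>c n m - d m\<bar> * t ^ m)"
      using summable_rabs[of "\<lambda>m. (c n m - d m) * t ^ m"] s(2) unfolding abs_eq by blast
    moreover have "(\<Sum>m. \<bar>c n m - d m\<bar> * t ^ m) \<le> (\<Sum>m. \<bar>c n m - d m\<bar> * T ^ m)"
      using t by (intro suminf_le s mult_left_mono power_mono) auto
    ultimately show ?thesis using t by (simp add: dist_real_def)
  qed
  show ?thesis
  proof (rule uniform_limitI)
    fix e :: real assume "e > 0"
    then have "\<forall>\<^sub>F n in sequentially. (\<Sum>m. \<bar>c n m - d m\<bar> * \<bar>T\<bar> ^ m) < e"
      using sup by (rule order_tendstoD(2)[rotated])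
    then show "\<forall>\<^sub>F n in sequentially. \<forall>t\<in>{0..T}.
        dist (\<Sum>m. c n m * t ^ m) (\<Sum>m. d m * t ^ m) < e"
      by (rule eventually_mono) (use le in \<open>blast intro: le_less_trans\<close>)
  qed
qed

text \<open>
  The bound \<open>C / m!\<close> is stable under differentiation with the same constant, so everything proved for the
  series applies to its derivative.
\<close>

lemma diffs_exp_bounded:
  fixes c :: "nat \<Rightarrow> real"
  assumes "\<And>m. \<bar>c m\<bar> \<le> C / fact m"
  shows "\<bar>diffs c m\<bar> \<le> C / fact m"
proof -
  have "\<bar>diffs c m\<bar> = real (Suc m) * \<bar>c (Suc m)\<bar>" by (simp add: diffs_def abs_mult)
  also have "\<dots> \<le> real (Suc m) * (C / fact (Suc m))" by (intro mult_left_mono assms) simp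
  also have "\<dots> = C / fact m" by (simp add: fact_Suc del: of_nat_Suc)
  finally show ?thesis .
qed

lemma powser_has_real_derivative:
  fixes c :: "nat \<Rightarrow> real"
  assumes "\<And>m. \<bar>c m\<bar> \<le> C / fact m"
  shows "((\<lambda>t. \<Sum>m. c m * t ^ m) has_real_derivative (\<Sum>m. diffs c m * t ^ m)) (at t)"
  by (rule termdiffs_strong_converges_everywhere) (rule summable_exp_bounded[OF assms])

section \<open>The entire function underlying the Bessel functions\<close>

definition bessel_series_coeff :: "real \<Rightarrow> nat \<Rightarrow> real" where
  "bessel_series_coeff a m = (-1) ^ m / (fact m * pochhammer a m)"

text \<open>
  The hypergeometric function \<open>0F1(; a; -t)\<close>. Unlike \<open>J_\<alpha>\<close> it is entire, and its zeros in \<open>t = x\<^sup>2 / 4\<close>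
  are those of \<open>J_{a-1}\<close> in \<open>x > 0\<close>.
\<close>

definition bessel_series :: "real \<Rightarrow> real \<Rightarrow> real" where
  "bessel_series a t = (\<Sum>m. bessel_series_coeff a m * t ^ m)"

lemma pochhammer_ge_1: "1 \<le> (a::real) \<Longrightarrow> 1 \<le> pochhammer a m"
proof (induction m)
  case (Suc m)
  then have "1 * 1 \<le> pochhammer a m * (a + real m)" by (intro mult_mono) auto
  then show ?case by (simp add: pochhammer_Suc)
qed simp

lemma pochhammer_ge_self: "0 < (a::real) \<Longrightarrow> 0 < m \<Longrightarrow> a \<le> pochhammer a m"
  using pochhammer_ge_1[of "a + 1" "m - 1"] mult_left_mono[of 1 "pochhammer (a + 1) (m - 1)" a]
  by (cases m) (simp_all add: pochhammer_rec)

lemma pochhammer_ge_min: "0 < (a::real) \<Longrightarrow> min a 1 \<le> pochhammer a m"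
  using pochhammer_ge_self[of a m] by (cases "m = 0") auto

lemma bessel_series_coeff_bound:
  assumes "0 < b" "b \<le> a"
  shows "\<bar>bessel_series_coeff a m\<bar> \<le> (1 / min b 1) / fact m"
proof -
  have "min b 1 \<le> pochhammer a m" using pochhammer_ge_min[of a m] assms by auto
  then have "inverse (pochhammer a m) \<le> inverse (min b 1)" using assms by (intro le_imp_inverse_le) auto
  moreover have "pochhammer a m > 0" using assms by (intro pochhammer_pos) auto
  ultimately have "inverse (fact m) * inverse (pochhammer a m) \<le> inverse (fact m) * inverse (min b 1)"
    by (intro mult_left_mono) auto
  then show ?thesis
    using \<open>pochhammer a m > 0\<close> by (simp add: bessel_series_coeff_def abs_mult field_simps)
qed

lemma summable_bessel_series: "0 < a \<Longrightarrow> summable (\<lambda>m. bessel_series_coeff a m * t ^ m)"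
  by (rule summable_exp_bounded, rule bessel_series_coeff_bound) auto

lemma bessel_series_0 [simp]: "bessel_series a 0 = 1"
  using powser_zero[of "bessel_series_coeff a"] by (simp add: bessel_series_def bessel_series_coeff_def)

lemma diffs_bessel_series_coeff:
  assumes "0 < a" shows "diffs (bessel_series_coeff a) m = - (1 / a) * bessel_series_coeff (a + 1) m"
proof -
  have "pochhammer (a + 1) m > 0" using assms by (intro pochhammer_pos) auto
  then show ?thesis using assms
    by (simp add: diffs_def bessel_series_coeff_def pochhammer_rec fact_Suc field_simps del: of_nat_Suc)
qed

lemma bessel_series_has_real_derivative:
  assumes "0 < a" shows "(bessel_series a has_real_derivative - (1 / a) * bessel_series (a + 1) t) (at t)"
proof -
  have "(bessel_series a has_real_derivative (\<Sum>m. diffs (bessel_series_coeff a) m * t ^ m)) (at t)"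
    unfolding bessel_series_def[abs_def]
    by (rule powser_has_real_derivative, rule bessel_series_coeff_bound) (use assms in auto)
  moreover have "(\<Sum>m. diffs (bessel_series_coeff a) m * t ^ m) = - (1 / a) * bessel_series (a + 1) t"
    using suminf_mult[OF summable_bessel_series[of "a + 1" t], of "- (1 / a)"] assms
    by (simp add: diffs_bessel_series_coeff bessel_series_def mult.assoc)
  ultimately show ?thesis by simp
qed

text \<open>
  This identity is the source of the shift from \<open>\<alpha>\<close> to \<open>\<alpha> + 2\<close> caused by a point mass.
\<close>

lemma bessel_series_contiguous:
  assumes a: "0 < a"
  shows "bessel_series a t - bessel_series (a + 1) t = - t / (a * (a + 1)) * bessel_series (a + 2) t"
proof -
  let ?d = "\<lambda>m. bessel_series_coeff a m * t ^ m - bessel_series_coeff (a + 1) m * t ^ m"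
  have d0: "?d 0 = 0" by (simp add: bessel_series_coeff_def)
  have dSuc: "?d (Suc k) = - t / (a * (a + 1)) * (bessel_series_coeff (a + 2) k * t ^ k)" for k
  proof -
    let ?p = "pochhammer (a + 2) k"
    have p: "?p > 0" using a by (intro pochhammer_pos) auto
    have 1: "pochhammer (a + 1) (Suc k) = (a + 1) * ?p"
      by (simp add: pochhammer_rec add.assoc)
    have "pochhammer (a + 1) k * (a + 1 + real k) = (a + 1) * ?p"
      using 1 by (simp add: pochhammer_Suc)
    then have 2: "pochhammer a (Suc k) = a * ((a + 1) * ?p / (a + 1 + real k))"
      using a by (simp add: pochhammer_rec field_simps)
    have "bessel_series_coeff a (Suc k) - bessel_series_coeff (a + 1) (Suc k)
        = - (1 / (a * (a + 1))) * bessel_series_coeff (a + 2) k"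
      unfolding bessel_series_coeff_def 1 2 using a p
      by (simp add: fact_Suc divide_simps del: of_nat_Suc) (simp add: algebra_simps)
    then have "(bessel_series_coeff a (Suc k) - bessel_series_coeff (a + 1) (Suc k)) * t ^ Suc k
        = - (1 / (a * (a + 1))) * bessel_series_coeff (a + 2) k * t ^ Suc k" by simp
    then show ?thesis by (simp add: algebra_simps)
  qed
  have s: "summable ?d" using summable_diff[OF summable_bessel_series[of a t] summable_bessel_series[of "a + 1" t]] a by simp
  have "bessel_series a t - bessel_series (a + 1) t = (\<Sum>m. ?d m)"
    unfolding bessel_series_def using a by (intro suminf_diff summable_bessel_series) auto
  also have "\<dots> = (\<Sum>k. ?d (Suc k))" using suminf_split_head[OF s] d0 by simp
  also have "\<dots> = - t / (a * (a + 1)) * bessel_series (a + 2) t"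
    unfolding dSuc bessel_series_def using a by (intro suminf_mult summable_bessel_series) auto
  finally show ?thesis .
qed

lemma bessel_series_tendsto_1:
  assumes a: "0 < a" and t: "0 \<le> t"
  shows "(\<lambda>k. bessel_series (a + real k) t) \<longlonglongrightarrow> 1"
proof -
  define d :: "nat \<Rightarrow> real" where "d m = (if m = 0 then 1 else 0)" for m
  have "(\<lambda>k. bessel_series_coeff (a + real k) m) \<longlonglongrightarrow> d m" for m
  proof (cases "m = 0")
    case False
    have "(\<lambda>k. bessel_series_coeff (a + real k) m) \<longlonglongrightarrow> 0"
    proof (rule tendsto_rabs_zero_cancel, rule tendsto_sandwich[of "\<lambda>_. 0"])
      have "\<bar>bessel_series_coeff (a + real k) m\<bar> \<le> inverse (a + real k)" for k
      proof -
        have "a + real k \<le> pochhammer (a + real k) m"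
          using a False by (intro pochhammer_ge_self) auto
        moreover have "1 \<le> (fact m :: real)" by simp
        ultimately have "1 * (a + real k) \<le> fact m * pochhammer (a + real k) m"
          using a by (intro mult_mono) auto
        then have "inverse (fact m * pochhammer (a + real k) m) \<le> inverse (a + real k)"
          using a by (intro le_imp_inverse_le) auto
        moreover have "pochhammer (a + real k) m > 0" using a by (intro pochhammer_pos) auto
        ultimately show ?thesis by (simp add: bessel_series_coeff_def abs_mult field_simps)
      qed
      then show "\<forall>\<^sub>F k in sequentially. \<bar>bessel_series_coeff (a + real k) m\<bar> \<le> inverse (a + real k)" by simp
      show "(\<lambda>k. inverse (a + real k)) \<longlonglongrightarrow> 0"
        by (intro tendsto_inverse_0_at_top filterlim_tendsto_add_at_top[OF tendsto_const] filterlim_real_sequentially)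
    qed auto
    then show ?thesis using False by (simp add: d_def)
  qed (simp add: d_def bessel_series_coeff_def)
  then have "uniform_limit {0..t} (\<lambda>k s. bessel_series (a + real k) s) (\<lambda>s. \<Sum>m. d m * s ^ m) sequentially"
    unfolding bessel_series_def by (intro uniform_limit_powser[OF bessel_series_coeff_bound[OF a]]) auto
  then have "(\<lambda>k. bessel_series (a + real k) t) \<longlonglongrightarrow> (\<Sum>m. d m * t ^ m)"
    using t by (auto dest: tendsto_uniform_limitI[of _ _ _ _ t])
  moreover have "(\<Sum>m. d m * t ^ m) = 1"
    using suminf_finite[of "{0}" "\<lambda>m. d m * t ^ m"] by (simp add: d_def)
  ultimately show ?thesis by simp
qed

text \<open>
  \<open>B_{a+1}\<close> is a multiple of \<open>B_a'\<close>, so this says that zeros are simple. A common zero would, by the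
  contiguous relation, be a zero of all \<open>B_{a+k}\<close>, which tend to 1.
\<close>

lemma bessel_series_no_common_zero:
  assumes a: "0 < a" and t: "0 \<le> t" and "bessel_series a t = 0"
  shows "bessel_series (a + 1) t \<noteq> 0"
proof
  assume "bessel_series (a + 1) t = 0"
  have "t > 0" using assms t by (cases "t = 0") auto
  have "bessel_series (a + real k) t = 0 \<and> bessel_series (a + real k + 1) t = 0" for k
  proof (induction k)
    case (Suc k)
    then have "t / ((a + real k) * (a + real k + 1)) * bessel_series (a + real k + 2) t = 0"
      using bessel_series_contiguous[of "a + real k" t] a by simp
    then have "bessel_series (a + real k + 2) t = 0" using a \<open>t > 0\<close> by auto
    then show ?case using Suc by (simp add: algebra_simps)
  qed (use assms \<open>bessel_series (a + 1) t = 0\<close> in simp)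
  then have "(\<lambda>k. bessel_series (a + real k) t) \<longlonglongrightarrow> 0" by simp
  then show False using bessel_series_tendsto_1[OF a t] LIMSEQ_unique by fastforce
qed

lemma bessel_series_half: "bessel_series (1/2) (x\<^sup>2 / 4) = cos x"
proof -
  have "bessel_series_coeff (1/2) m * (x\<^sup>2 / 4) ^ m = (-1) ^ m / fact (2 * m) * x ^ (2 * m)" for m
  proof -
    have "(fact (2 * m) :: real) = 4 ^ m * pochhammer (1/2) m * fact m"
      by (simp add: fact_double power_mult)
    then show ?thesis by (simp add: bessel_series_coeff_def power_divide power_mult)
  qed
  then show ?thesis using sums_unique[OF cos_paired[of x]] by (simp add: bessel_series_def)
qed

text \<open>
  The zeros of the cosine start the induction; Rolle's theorem carries it on, \<open>B_{a+1}\<close> being a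
  multiple of \<open>B_a'\<close>.
\<close>

lemma bessel_series_zeros_unbounded: "\<exists>t>u. bessel_series (1/2 + real k) t = 0"
proof (induction k arbitrary: u)
  case 0
  obtain N :: nat where N: "\<bar>4 * u\<bar> + 1 < real N" using reals_Archimedean2 by blast
  define x where "x = real (2 * N + 1) * (pi / 2)"
  have "real N \<le> real (2 * N + 1) * 1" by simp
  also have "\<dots> \<le> x" unfolding x_def using pi_ge_two by (intro mult_left_mono) auto
  finally have x: "real N \<le> x" .
  then have "1 * x \<le> x * x" using N by (intro mult_right_mono) auto
  then have "u < x\<^sup>2 / 4" using x N by (simp add: power2_eq_square)
  moreover have "cos x = 0" unfolding cos_zero_iff x_def
    by (intro disjI1 exI[of _ "2 * N + 1"]) simp
  ultimately show ?case using bessel_series_half[of x] by (intro exI[of _ "x\<^sup>2 / 4"]) simp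
next
  case (Suc k)
  obtain r where r: "r > u" "bessel_series (1/2 + real k) r = 0" using Suc by blast
  obtain s where s: "s > r" "bessel_series (1/2 + real k) s = 0" using Suc by blast
  note der = bessel_series_has_real_derivative[of "1/2 + real k"]
  obtain z where z: "r < z" "z < s"
    "bessel_series (1/2 + real k) s - bessel_series (1/2 + real k) r
      = (s - r) * (- (1 / (1/2 + real k)) * bessel_series (1/2 + real k + 1) z)"
    using MVT2[OF s(1), of "bessel_series (1/2 + real k)"] der by fastforce
  then have "bessel_series (1/2 + real k + 1) z = 0" using r s by (simp add: add_pos_nonneg)
  then show ?case using z(1) r(1) by (intro exI[of _ z]) (simp add: algebra_simps)
qed

lemma bessel_J_eq_bessel_series:
  assumes "0 < x" "0 < \<alpha> + 1"
  shows "bessel_J \<alpha> x = (x / 2) powr \<alpha> * rGamma (\<alpha> + 1) * bessel_series (\<alpha> + 1) (x\<^sup>2 / 4)"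
proof -
  have "(-1) ^ m / fact m * rGamma (real m + \<alpha> + 1) * (x / 2) powr (2 * real m + \<alpha>)
      = (x / 2) powr \<alpha> * rGamma (\<alpha> + 1) * (bessel_series_coeff (\<alpha> + 1) m * (x\<^sup>2 / 4) ^ m)" for m
  proof -
    have "(x / 2) powr (2 * real m) = (x / 2) powr real (2 * m)" by simp
    also have "\<dots> = (x / 2) ^ (2 * m)" using assms by (subst powr_realpow) auto
    also have "\<dots> = (x\<^sup>2 / 4) ^ m" by (simp add: power_mult power_divide)
    finally have 1: "(x / 2) powr (2 * real m + \<alpha>) = (x\<^sup>2 / 4) ^ m * (x / 2) powr \<alpha>"
      by (simp add: powr_add)
    have "pochhammer (\<alpha> + 1) m > 0" using assms by (intro pochhammer_pos) auto
    moreover have "rGamma (\<alpha> + 1) = pochhammer (\<alpha> + 1) m * rGamma (real m + \<alpha> + 1)"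
      using pochhammer_rGamma[of "\<alpha> + 1" m] by (simp add: algebra_simps)
    ultimately show ?thesis unfolding 1 by (simp add: bessel_series_coeff_def field_simps)
  qed
  then show ?thesis unfolding bessel_J_def bessel_series_def
    using suminf_mult[OF summable_bessel_series[of "\<alpha> + 1" "x\<^sup>2 / 4"]] assms by simp
qed

lemma bessel_J_eq_0_iff:
  assumes "0 < x" "0 < \<alpha> + 1"
  shows "bessel_J \<alpha> x = 0 \<longleftrightarrow> bessel_series (\<alpha> + 1) (x\<^sup>2 / 4) = 0"
proof -
  have "rGamma (\<alpha> + 1) \<noteq> 0"
    using assms(2) by (auto simp: rGamma_eq_zero_iff elim!: nonpos_Ints_cases)
  then show ?thesis using assms by (simp add: bessel_J_eq_bessel_series)
qed

lemma bessel_series_kth_zero: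
  obtains s where "is_kth {t. 0 < t \<and> bessel_series (1/2 + real j) t = 0} (Suc k) s"
    "bessel_zero (real j - 1/2) (Suc k) = 2 * sqrt s"
proof -
  let ?a = "1/2 + real j"
  let ?S = "{t. 0 < t \<and> bessel_series ?a t = 0}"
  have "continuous_on UNIV (bessel_series b)" if "0 < b" for b
    using bessel_series_has_real_derivative[OF that] DERIV_isCont
    by (intro continuous_at_imp_continuous_on) blast
  then have cont: "continuous_on UNIV (\<lambda>t. - (1 / ?a) * bessel_series (?a + 1) t)"
    by (intro continuous_intros) simp
  have "finite {t. 0 \<le> t \<and> t \<le> u \<and> bessel_series ?a t = 0}" for u
  proof (rule finite_simple_zeros[OF _ cont])
    show "(bessel_series ?a has_real_derivative - (1 / ?a) * bessel_series (?a + 1) t) (at t)" for t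
      by (rule bessel_series_has_real_derivative) simp
    show "- (1 / ?a) * bessel_series (?a + 1) t \<noteq> 0" if "0 \<le> t" "bessel_series ?a t = 0" for t
      using bessel_series_no_common_zero[of ?a t] that by (simp add: add_nonneg_eq_0_iff)
  qed
  then have "finite {t \<in> ?S. t \<le> u}" for u
    by (rule finite_subset[rotated]) auto
  moreover have "\<exists>t\<in>?S. u < t" for u
    using bessel_series_zeros_unbounded[of "max u 0" j] by auto
  ultimately obtain s where s: "is_kth ?S (Suc k) s" using is_kth_exists[of ?S k] by blast
  have "strict_mono_on ?S (\<lambda>t. 2 * sqrt t)" by (intro strict_mono_onI) simp
  then have "is_kth ((\<lambda>t. 2 * sqrt t) ` ?S) (Suc k) (2 * sqrt s)" by (rule is_kth_image[OF s])
  also have "(\<lambda>t. 2 * sqrt t) ` ?S = {x. 0 < x \<and> bessel_J (real j - 1/2) x = 0}"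
  proof (intro equalityI subsetI)
    fix x assume "x \<in> (\<lambda>t. 2 * sqrt t) ` ?S"
    then obtain t where t: "0 < t" "bessel_series ?a t = 0" "x = 2 * sqrt t" by auto
    then have "x\<^sup>2 / 4 = t" by (simp add: power_mult_distrib)
    then show "x \<in> {x. 0 < x \<and> bessel_J (real j - 1/2) x = 0}"
      using t bessel_J_eq_0_iff[of x "real j - 1/2"] by (simp add: add.commute)
  next
    fix x assume "x \<in> {x. 0 < x \<and> bessel_J (real j - 1/2) x = 0}"
    then have "0 < x" "bessel_series ?a (x\<^sup>2 / 4) = 0"
      using bessel_J_eq_0_iff[of x "real j - 1/2"] by (auto simp: add.commute)
    then show "x \<in> (\<lambda>t. 2 * sqrt t) ` ?S"
      by (intro image_eqI[of _ _ "x\<^sup>2 / 4"]) (auto simp: real_sqrt_divide)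
  qed
  finally have "bessel_zero (real j - 1/2) (Suc k) = 2 * sqrt s"
    unfolding bessel_zero_def by (rule kth_least_eq)
  then show thesis using that s by blast
qed

section \<open>Alternating binomial sums\<close>

text \<open>
  The sum is an \<open>n\<close>-th finite difference at 0, up to sign; this is its recursion.
\<close>

lemma sum_alternating_binomial_Suc:
  fixes f :: "nat \<Rightarrow> real"
  shows "(\<Sum>m\<le>Suc n. (-1) ^ m * real (Suc n choose m) * f m)
    = (\<Sum>m\<le>n. (-1) ^ m * real (n choose m) * (f m - f (Suc m)))"
proof -
  have "(-1) ^ Suc m * real (Suc n choose Suc m) * f (Suc m)
      = (-1) ^ Suc m * real (n choose Suc m) * f (Suc m) - (-1) ^ m * real (n choose m) * f (Suc m)" for m
    by (simp add: algebra_simps)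
  then have "(\<Sum>m\<le>Suc n. (-1) ^ m * real (Suc n choose m) * f m)
      = f 0 + (\<Sum>m\<le>n. (-1) ^ Suc m * real (n choose Suc m) * f (Suc m))
        - (\<Sum>m\<le>n. (-1) ^ m * real (n choose m) * f (Suc m))"
    by (subst sum.atMost_Suc_shift) (simp add: sum_subtractf del: binomial_Suc_Suc power_Suc)
  also have "f 0 + (\<Sum>m\<le>n. (-1) ^ Suc m * real (n choose Suc m) * f (Suc m))
      = (\<Sum>m\<le>Suc n. (-1) ^ m * real (n choose m) * f m)"
    by (subst sum.atMost_Suc_shift) simp
  also have "\<dots> = (\<Sum>m\<le>n. (-1) ^ m * real (n choose m) * f m)" by simp
  finally show ?thesis by (simp add: sum_subtractf algebra_simps)
qed

text \<open>
  The \<open>n\<close>-th difference of a polynomial of degree \<open>j < n\<close>.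
\<close>

lemma sum_alternating_binomial_pochhammer:
  fixes a :: real
  assumes "j < n"
  shows "(\<Sum>m\<le>n. (-1) ^ m * real (n choose m) * pochhammer (a + real m) j) = 0"
  using assms
proof (induction n arbitrary: a j)
  case (Suc n)
  show ?case
  proof (cases j)
    case 0
    then show ?thesis by (subst sum_alternating_binomial_Suc) simp
  next
    case (Suc k)
    have "pochhammer x (Suc k) - pochhammer (x + 1) (Suc k) = - real (Suc k) * pochhammer (x + 1) k"
      for x :: real
      by (subst pochhammer_rec, subst pochhammer_Suc) (simp add: algebra_simps)
    from this[of "a + real m" for m]
    have diff: "pochhammer (a + real m) (Suc k) - pochhammer (a + real (Suc m)) (Suc k)
      = - real (Suc k) * pochhammer (a + 1 + real m) k" for m
      by (simp add: algebra_simps)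
    have "(\<Sum>m\<le>Suc n. (-1) ^ m * real (Suc n choose m) * pochhammer (a + real m) j)
      = - real (Suc k) * (\<Sum>m\<le>n. (-1) ^ m * real (n choose m) * pochhammer (a + 1 + real m) k)"
      unfolding sum_alternating_binomial_Suc Suc diff by (simp add: sum_distrib_left algebra_simps)
    also have "\<dots> = 0" using Suc.IH[of k "a + 1"] Suc.prems Suc by simp
    finally show ?thesis .
  qed
qed simp

lemma sum_alternating_binomial_inverse:
  fixes a :: real
  assumes "0 < a"
  shows "(\<Sum>m\<le>n. (-1) ^ m * real (n choose m) * (1 / (a + real m))) = fact n / pochhammer a (Suc n)"
  using assms
proof (induction n arbitrary: a)
  case (Suc n)
  let ?p = "pochhammer (a + 1) n"
  have p: "?p > 0" using Suc.prems by (intro pochhammer_pos) auto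
  have "(\<Sum>m\<le>Suc n. (-1) ^ m * real (Suc n choose m) * (1 / (a + real m)))
      = (\<Sum>m\<le>n. (-1) ^ m * real (n choose m) * (1 / (a + real m)))
        - (\<Sum>m\<le>n. (-1) ^ m * real (n choose m) * (1 / (a + 1 + real m)))"
    unfolding sum_alternating_binomial_Suc
    by (simp add: sum_subtractf algebra_simps)
  also have "\<dots> = fact n / pochhammer a (Suc n) - fact n / pochhammer (a + 1) (Suc n)"
    using Suc.IH[of a] Suc.IH[of "a + 1"] Suc.prems by simp
  also have "\<dots> = fact n / (a * ?p) - fact n / (?p * (a + 1 + real n))"
    using pochhammer_rec[of a n] pochhammer_Suc[of "a + 1" n] by simp
  also have "\<dots> = fact (Suc n) / (a * (?p * (a + 1 + real n)))"
  proof -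
    have "r / (a * x) - r / (x * y) = r * (y - a) / (a * (x * y))" if "x > 0" "y > 0" for r x y
      using that Suc.prems by (simp add: divide_simps) (simp add: algebra_simps)
    from this[of ?p "a + 1 + real n" "fact n"] show ?thesis
      using p Suc.prems by (simp add: algebra_simps)
  qed
  also have "a * (?p * (a + 1 + real n)) = pochhammer a (Suc (Suc n))"
    by (simp add: pochhammer_rec[of a "Suc n"] pochhammer_Suc[of "a + 1" n])
  finally show ?case .
qed simp

section \<open>The orthogonal polynomials\<close>

text \<open>
  Coefficient of \<open>t\<^sup>m\<close> in \<open>L_n^(a-1) - \<theta> L_{n-1}^(a)\<close>, each Laguerre polynomial being divided by its value at 0.
\<close>

definition laguerre_coeff :: "real \<Rightarrow> real \<Rightarrow> nat \<Rightarrow> nat \<Rightarrow> real" where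
  "laguerre_coeff a \<theta> n m = (-1) ^ m *
     (real (n choose m) / pochhammer a m - \<theta> * (real (n - 1 choose m) / pochhammer (a + 1) m))"

text \<open>
  The integral of \<open>L_{n-1}^(a)\<close>, normalised to value 1 at 0, against the probability density proportional to
  \<open>t\<^sup>a\<^sup>-\<^sup>1 e\<^sup>-\<^sup>t\<close>. As this polynomial is a multiple of the reproducing kernel at the origin, it is also the
  reciprocal of the kernel at (0, 0).
\<close>

definition kernel_norm :: "real \<Rightarrow> nat \<Rightarrow> real" where
  "kernel_norm a n = fact (n - 1) / pochhammer (a + 1) (n - 1)"

text \<open>
  Since \<open>(a)_{m+i}\<close> is proportional to the moment of order \<open>m + i\<close> of \<open>t\<^sup>a\<^sup>-\<^sup>1 e\<^sup>-\<^sup>t\<close>, this is the inner product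
  with \<open>t\<^sup>i\<close>, apart from the point mass. The first Laguerre polynomial is orthogonal to all these powers; for the
  second, a factor \<open>t\<close> raises the weight to \<open>t\<^sup>a e\<^sup>-\<^sup>t\<close>, for which it is orthogonal, and only \<open>i = 0\<close> survives.
\<close>

lemma laguerre_coeff_orthogonal:
  assumes a: "0 < a" and "i < n"
  shows "(\<Sum>m\<le>n. laguerre_coeff a \<theta> n m * pochhammer a (m + i))
    = (if i = 0 then - \<theta> * kernel_norm a n else 0)"
proof -
  obtain N where n: "n = Suc N" using assms by (cases n) auto
  have pos: "pochhammer a m > 0" "pochhammer (a + 1) m > 0" for m
    using a by (auto intro!: pochhammer_pos)
  have split: "pochhammer a (m + i) / pochhammer a m = pochhammer (a + real m) i" for m
    using pos(1)[of m] by (simp add: pochhammer_product')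
  have "(\<Sum>m\<le>n. laguerre_coeff a \<theta> n m * pochhammer a (m + i))
      = (\<Sum>m\<le>n. (-1) ^ m * real (n choose m) * pochhammer (a + real m) i)
        - \<theta> * (\<Sum>m\<le>n. (-1) ^ m * real (N choose m) * (pochhammer a (m + i) / pochhammer (a + 1) m))"
    unfolding sum_distrib_left sum_subtractf[symmetric] split[symmetric] laguerre_coeff_def
    by (intro sum.cong refl) (simp add: n algebra_simps)
  also have "(\<Sum>m\<le>n. (-1) ^ m * real (n choose m) * pochhammer (a + real m) i) = 0"
    by (rule sum_alternating_binomial_pochhammer) fact
  also have "(\<Sum>m\<le>n. (-1) ^ m * real (N choose m) * (pochhammer a (m + i) / pochhammer (a + 1) m))
      = (\<Sum>m\<le>N. (-1) ^ m * real (N choose m) * (pochhammer a (m + i) / pochhammer (a + 1) m))"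
    by (simp add: n)
  also have "\<dots> = (if i = 0 then kernel_norm a n else 0)"
  proof (cases i)
    case 0
    have "pochhammer a m / pochhammer (a + 1) m = a * (1 / (a + real m))" for m
      using pochhammer_rec[of a m] pochhammer_Suc[of a m] pos(2)[of m] a
      by (simp add: field_simps)
    then have "(\<Sum>m\<le>N. (-1) ^ m * real (N choose m) * (pochhammer a (m + i) / pochhammer (a + 1) m))
        = a * (\<Sum>m\<le>N. (-1) ^ m * real (N choose m) * (1 / (a + real m)))"
      by (simp add: 0 sum_distrib_left algebra_simps)
    also have "\<dots> = kernel_norm a n"
      unfolding sum_alternating_binomial_inverse[OF a] kernel_norm_def
      using a by (simp add: n pochhammer_rec)
    finally show ?thesis by (simp add: 0)
  next
    case (Suc k)
    have "pochhammer a (m + i) / pochhammer (a + 1) m = a * pochhammer (a + 1 + real m) k" for m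
      using pos(2)[of m] pochhammer_product'[of "a + 1" m k]
      by (simp add: Suc pochhammer_rec[of a "m + k"])
    then have "(\<Sum>m\<le>N. (-1) ^ m * real (N choose m) * (pochhammer a (m + i) / pochhammer (a + 1) m))
        = a * (\<Sum>m\<le>N. (-1) ^ m * real (N choose m) * pochhammer (a + 1 + real m) k)"
      by (simp add: sum_distrib_left algebra_simps)
    also have "\<dots> = 0"
      using sum_alternating_binomial_pochhammer[of k N "a + 1"] assms(2) Suc n by simp
    finally show ?thesis by (simp add: Suc)
  qed
  finally show ?thesis by simp
qed

lemma kernel_norm_pos: "0 < a \<Longrightarrow> 0 < kernel_norm a n"
  unfolding kernel_norm_def by (intro divide_pos_pos pochhammer_pos) auto

lemma kernel_norm_tendsto_0:
  assumes a: "0 < a" shows "kernel_norm a \<longlonglongrightarrow> 0"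
proof -
  have eq: "kernel_norm a (Suc n) = a * (Gamma_series a n * exp (- a * ln (real n)))" for n
  proof -
    have "Gamma_series a n * exp (- a * ln (real n)) = fact n / pochhammer a (Suc n)"
      by (simp add: Gamma_series_def mult_exp_exp[symmetric] exp_minus field_simps)
    then show ?thesis using a by (simp add: kernel_norm_def pochhammer_rec)
  qed
  \<comment> \<open>Gauss's product formula: the norm decays like \<open>\<Gamma>(a + 1) n\<^sup>-\<^sup>a\<close>.\<close>
  have "LIM n sequentially. - a * ln (real n) :> at_bot"
    using a by (intro filterlim_tendsto_neg_mult_at_bot[OF tendsto_const]
        filterlim_compose[OF ln_at_top] filterlim_real_sequentially) auto
  then have "(\<lambda>n. exp (- a * ln (real n))) \<longlonglongrightarrow> 0"
    by (rule filterlim_compose[OF exp_at_bot])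
  then have "(\<lambda>n. a * (Gamma_series a n * exp (- a * ln (real n)))) \<longlonglongrightarrow> a * (Gamma a * 0)"
    by (intro tendsto_intros)
  then have "(\<lambda>n. kernel_norm a (Suc n)) \<longlonglongrightarrow> 0" unfolding eq by simp
  then show ?thesis by (rule LIMSEQ_imp_Suc)
qed

lemma gauss_moment_even:
  "has_bochner_integral lborel (\<lambda>x. x ^ (2 * k) * exp (- x\<^sup>2)) (sqrt pi * pochhammer (1/2) k)"
proof -
  have "(fact (2 * k) :: real) / (2 ^ (2 * k) * fact k) = pochhammer (1/2) k"
    by (simp add: fact_double)
  then show ?thesis
    using has_bochner_integral_even_function[OF gaussian_moment_even_pos[of k]]
    by (simp add: mult.commute)
qed

lemma gauss_moment_odd:
  "has_bochner_integral lborel (\<lambda>x::real. x ^ (2 * k + 1) * exp (- x\<^sup>2)) 0"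
  using has_bochner_integral_odd_function[OF gaussian_moment_odd_pos[of k]]
  by (simp add: mult.commute[of "exp _"])

definition gauss_moment :: "nat \<Rightarrow> real" where
  "gauss_moment i = (if even i then sqrt pi * pochhammer (1/2) (i div 2) else 0)"

lemma has_gauss_moment:
  "has_bochner_integral lborel (\<lambda>x. x ^ i * exp (- x\<^sup>2)) (gauss_moment i)"
  using gauss_moment_even[of "i div 2"] gauss_moment_odd[of "i div 2"]
  by (cases "even i") (auto simp: gauss_moment_def)

lemma has_gauss_integral_poly:
  "has_bochner_integral lborel (\<lambda>x. poly p x * exp (- x\<^sup>2)) (\<Sum>i\<le>degree p. coeff p i * gauss_moment i)"
proof -
  have "has_bochner_integral lborel (\<lambda>x. \<Sum>i\<le>degree p. coeff p i * (x ^ i * exp (- x\<^sup>2)))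
      (\<Sum>i\<le>degree p. coeff p i * gauss_moment i)"
    by (intro has_bochner_integral_sum has_bochner_integral_mult_right has_gauss_moment)
  then show ?thesis by (simp add: poly_altdef sum_distrib_right mult.assoc)
qed

lemma integrable_gauss_poly: "integrable lborel (\<lambda>x::real. poly p x * exp (- x\<^sup>2))"
  using has_gauss_integral_poly by (rule integrable.intros)

lemma integrable_gauss_poly2: "integrable lborel (\<lambda>x::real. poly p x * poly q x * exp (- x\<^sup>2))"
  using integrable_gauss_poly[of "p * q"] by simp

lemma hermite_sobolev_sym: "hermite_sobolev M0 M1 p q = hermite_sobolev M0 M1 q p"
  by (simp add: hermite_sobolev_def ac_simps)

lemma hermite_sobolev_add:
  "hermite_sobolev M0 M1 p (q + r) = hermite_sobolev M0 M1 p q + hermite_sobolev M0 M1 p r"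
proof -
  have "(\<integral>x. poly p x * poly (q + r) x * exp (- x\<^sup>2) \<partial>lborel)
     = (\<integral>x. poly p x * poly q x * exp (- x\<^sup>2) + poly p x * poly r x * exp (- x\<^sup>2) \<partial>lborel)"
    by (simp add: algebra_simps)
  also have "\<dots> = (\<integral>x. poly p x * poly q x * exp (- x\<^sup>2) \<partial>lborel)
      + (\<integral>x. poly p x * poly r x * exp (- x\<^sup>2) \<partial>lborel)"
    by (intro Bochner_Integration.integral_add integrable_gauss_poly2)
  finally show ?thesis by (simp add: hermite_sobolev_def pderiv_add algebra_simps)
qed

lemma hermite_sobolev_smult:
  "hermite_sobolev M0 M1 p (smult c q) = c * hermite_sobolev M0 M1 p q"
proof -
  have "(\<integral>x. poly p x * poly (smult c q) x * exp (- x\<^sup>2) \<partial>lborel)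
     = (\<integral>x. c * (poly p x * poly q x * exp (- x\<^sup>2)) \<partial>lborel)"
    by (simp add: algebra_simps)
  also have "\<dots> = c * (\<integral>x. poly p x * poly q x * exp (- x\<^sup>2) \<partial>lborel)" by simp
  finally show ?thesis by (simp add: hermite_sobolev_def pderiv_smult algebra_simps)
qed

lemma hermite_sobolev_monom:
  "hermite_sobolev M0 M1 (monom 1 j) (monom 1 i) = gauss_moment (i + j)
    + (if i = 0 \<and> j = 0 then M0 else 0) + (if i = 1 \<and> j = 1 then M1 else 0)"
proof -
  have "(\<integral>x. poly (monom 1 j) x * poly (monom 1 i) x * exp (- x\<^sup>2) \<partial>lborel) = gauss_moment (i + j)"
    using has_bochner_integral_integral_eq[OF has_gauss_moment[of "i + j"]]
    by (simp add: poly_monom power_add mult.commute)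
  then show ?thesis
    by (auto simp: hermite_sobolev_def poly_monom pderiv_monom power_0_left)
qed

text \<open>
  The integral of \<open>p\<^sup>2\<close> can vanish only if \<open>p\<close> is zero almost everywhere, but a nonzero polynomial has finitely
  many roots.
\<close>

lemma hermite_sobolev_definite:
  assumes "M0 \<ge> 0" "M1 \<ge> 0" "hermite_sobolev M0 M1 p p = 0"
  shows "p = 0"
proof (rule ccontr)
  assume "p \<noteq> 0"
  let ?I = "\<integral>x. poly p x * poly p x * exp (- x\<^sup>2) \<partial>lborel"
  have "?I \<ge> 0" by (intro Bochner_Integration.integral_nonneg) simp
  moreover have "0 \<le> M0 * poly p 0 * poly p 0" "0 \<le> M1 * poly (pderiv p) 0 * poly (pderiv p) 0"
    using assms by (auto simp: mult.assoc)
  ultimately have "?I = 0" using assms(3) unfolding hermite_sobolev_def by linarith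
  then have "AE x in lborel. poly p x * poly p x * exp (- x\<^sup>2) = 0"
    by (subst (asm) integral_nonneg_eq_0_iff_AE) (auto intro: integrable_gauss_poly2)
  then have "AE x in lborel. poly p x = 0" by simp
  moreover have "AE x in lborel. x \<notin> {x. poly p x = 0}"
    using poly_roots_finite[OF \<open>p \<noteq> 0\<close>]
    by (intro AE_not_in finite_imp_null_set_lborel)
  ultimately have "AE x in (lborel :: real measure). False" by eventually_elim simp
  then show False by (simp add: eventually_False ae_filter_eq_bot_iff)
qed

text \<open>
  A monic family with one member in each degree spans the polynomials of degree below \<open>N\<close>. It is used both with
  an orthogonal family and with the monomials.
\<close>

lemma linear_functional_eq_0:
  fixes E :: "nat \<Rightarrow> real poly" and L :: "real poly \<Rightarrow> real"
  assumes add: "\<And>p q. L (p + q) = L p + L q" and smult: "\<And>c p. L (smult c p) = c * L p"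
    and E: "\<And>d. d < N \<Longrightarrow> coeff (E d) d = 1 \<and> (\<forall>i>d. coeff (E d) i = 0) \<and> L (E d) = 0"
    and p: "\<And>i. i \<ge> N \<Longrightarrow> coeff p i = 0"
  shows "L p = 0"
  using E p
proof (induction N arbitrary: p)
  case 0
  then have "p = 0" by (simp add: poly_eq_iff)
  then show ?case using smult[of 0 0] by simp
next
  case (Suc N)
  let ?q = "p + smult (- coeff p N) (E N)"
  have "L ?q = 0"
  proof (rule Suc.IH)
    show "coeff ?q i = 0" if "N \<le> i" for i
      using Suc.prems(1)[of N] Suc.prems(2)[of i] that by (cases "i = N") auto
  qed (use Suc.prems(1) in auto)
  then show ?case unfolding add smult using Suc.prems(1)[of N] by simp
qed

text \<open>
  The difference of the two monic polynomials has degree below \<open>N\<close>, hence is orthogonal to both, hence to itself.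
\<close>

lemma monic_orthogonal_unique:
  assumes "M0 \<ge> 0" "M1 \<ge> 0" and Q: "monic_orthogonal (hermite_sobolev M0 M1) Q"
    and deg: "\<And>i. i > N \<Longrightarrow> coeff W i = 0" and lc: "coeff W N \<noteq> 0"
    and orth: "\<And>j. j < N \<Longrightarrow> hermite_sobolev M0 M1 W (monom 1 j) = 0"
  shows "Q N = smult (1 / coeff W N) W"
proof -
  let ?B = "hermite_sobolev M0 M1"
  let ?D = "Q N + smult (- 1 / coeff W N) W"
  have Qdeg: "coeff (Q d) d = 1" "i > d \<Longrightarrow> coeff (Q d) i = 0" for d i
    using Q unfolding monic_orthogonal_def by (metis, metis coeff_eq_0)
  have Qorth: "m \<noteq> n \<Longrightarrow> ?B (Q m) (Q n) = 0" for m n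
    using Q unfolding monic_orthogonal_def by blast
  have low: "coeff ?D i = 0" if "i \<ge> N" for i
    using that Qdeg[of N] deg[of i] lc by (cases "i = N") auto
  have "?B (Q N) ?D = 0"
    using hermite_sobolev_add hermite_sobolev_smult
    by (rule linear_functional_eq_0[where E = Q and N = N]) (use Qdeg Qorth low in auto)
  moreover have "?B W ?D = 0"
    using hermite_sobolev_add hermite_sobolev_smult
    by (rule linear_functional_eq_0[where E = "monom 1" and N = N]) (use orth low in auto)
  ultimately have "?B ?D ?D = 0"
    using hermite_sobolev_add[of M0 M1 ?D "Q N" "smult (- 1 / coeff W N) W"]
      hermite_sobolev_smult[of M0 M1 ?D "- 1 / coeff W N" W]
      hermite_sobolev_sym[of M0 M1 ?D "Q N"] hermite_sobolev_sym[of M0 M1 ?D W] by simp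
  then have "?D = 0" by (rule hermite_sobolev_definite[OF assms(1,2)])
  then show ?thesis by (simp add: add_eq_0_iff)
qed

text \<open>
  The polynomial \<open>x\<^sup>e R (x\<^sup>2)\<close>, where \<open>R\<close> has coefficients \<open>w\<close>.
\<close>

definition spread_poly :: "nat \<Rightarrow> (nat \<Rightarrow> real) \<Rightarrow> nat \<Rightarrow> real poly" where
  "spread_poly e w n = (\<Sum>m\<le>n. monom (w m) (2 * m + e))"

lemma poly_spread_poly: "poly (spread_poly e w n) x = x ^ e * (\<Sum>m\<le>n. w m * (x\<^sup>2) ^ m)"
  by (simp add: spread_poly_def poly_sum poly_monom power_add power_mult[symmetric] sum_distrib_left ac_simps)

lemma coeff_spread_poly_top: "coeff (spread_poly e w n) (2 * n + e) = w n"
  by (simp add: spread_poly_def coeff_sum)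

lemma coeff_spread_poly_above: "2 * n + e < i \<Longrightarrow> coeff (spread_poly e w n) i = 0"
  by (auto simp: spread_poly_def coeff_sum intro!: sum.neutral)

lemma hermite_sobolev_spread_poly:
  assumes "e \<le> 1"
  shows "hermite_sobolev M0 M1 (spread_poly e w n) (monom 1 j)
    = (if even (e + j) then (\<Sum>m\<le>n. w m * gauss_moment (2 * m + e + j)) else 0)
      + (if j = e then (if e = 0 then M0 else M1) * w 0 else 0)"
proof -
  have lin: "hermite_sobolev M0 M1 q (\<Sum>m\<in>A. monom (w m) (2 * m + e))
      = (\<Sum>m\<in>A. w m * hermite_sobolev M0 M1 q (monom 1 (2 * m + e)))" if "finite A" for A q
    using that
  proof induction
    case empty
    show ?case using hermite_sobolev_smult[of M0 M1 q 0 0] by simp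
  next
    case (insert m A)
    have "monom (w m) (2 * m + e) = smult (w m) (monom 1 (2 * m + e))" by (simp add: smult_monom)
    then show ?case using insert by (simp add: hermite_sobolev_add hermite_sobolev_smult)
  qed
  have "hermite_sobolev M0 M1 (spread_poly e w n) (monom 1 j)
      = (\<Sum>m\<le>n. w m * hermite_sobolev M0 M1 (monom 1 j) (monom 1 (2 * m + e)))"
    unfolding spread_poly_def by (subst hermite_sobolev_sym) (simp add: lin)
  also have "\<dots> = (\<Sum>m\<le>n. w m * gauss_moment (2 * m + e + j)
      + (if m = 0 then (if j = e then (if e = 0 then M0 else M1) * w 0 else 0) else 0))"
    unfolding hermite_sobolev_monom using assms
    by (intro sum.cong refl) (auto simp: algebra_simps)
  also have "\<dots> = (\<Sum>m\<le>n. w m * gauss_moment (2 * m + e + j))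
      + (if j = e then (if e = 0 then M0 else M1) * w 0 else 0)"
    by (simp add: sum.distrib)
  finally show ?thesis by (auto simp: gauss_moment_def intro!: sum.neutral)
qed

text \<open>
  The value of \<open>\<theta>\<close> for which orthogonality to 1 holds: it solves \<open>M (1 - \<theta>) = \<theta> \<kappa>\<close>, where \<open>1 - \<theta>\<close> is the value of
  the polynomial at 0 and \<open>\<kappa>\<close> is the integral of \<open>L_{n-1}^(a)\<close>; \<open>kernel_norm\<close> is multiplied by the total mass of
  \<open>x^(2 e) exp (- x\<^sup>2)\<close>.
\<close>

definition mass_ratio :: "nat \<Rightarrow> real \<Rightarrow> nat \<Rightarrow> real" where
  "mass_ratio e M n = M / (M + sqrt pi * pochhammer (1/2) e * kernel_norm (1/2 + real e) n)"

text \<open>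
  Monomials of the wrong parity are orthogonal by symmetry, those \<open>x\<^sup>2\<^sup>i\<^sup>+\<^sup>e\<close> with \<open>i > 0\<close> by orthogonality of the
  Laguerre polynomials, and \<open>x\<^sup>e\<close> by the choice of \<open>\<theta>\<close>.
\<close>

lemma sobolev_polynomial_eq:
  assumes "M0 \<ge> 0" "M1 \<ge> 0" and Q: "monic_orthogonal (hermite_sobolev M0 M1) Q"
    and e: "e \<le> 1" and n: "0 < n"
  defines "M \<equiv> if e = 0 then M0 else M1"
  defines "w \<equiv> laguerre_coeff (1/2 + real e) (mass_ratio e M n) n"
  shows "w n \<noteq> 0" "Q (2 * n + e) = smult (1 / w n) (spread_poly e w n)"
proof -
  let ?a = "1/2 + real e"
  let ?s = "sqrt pi * pochhammer (1/2) e"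
  have pos: "pochhammer ?a m > 0" "pochhammer (1/2 :: real) e > 0" for m
    by (auto intro!: pochhammer_pos)
  have "M \<ge> 0" using assms by (simp add: M_def)
  moreover have "?s * kernel_norm ?a n > 0"
    by (intro mult_pos_pos kernel_norm_pos pos) auto
  ultimately have denom: "M + ?s * kernel_norm ?a n > 0" by linarith
  show wn: "w n \<noteq> 0" using n pos(1)[of n] by (simp add: w_def laguerre_coeff_def binomial_eq_0)
  have w0: "w 0 = 1 - mass_ratio e M n" by (simp add: w_def laguerre_coeff_def)
  have orth: "hermite_sobolev M0 M1 (spread_poly e w n) (monom 1 j) = 0" if j: "j < 2 * n + e" for j
  proof (cases "even (e + j)")
    case False
    then show ?thesis using hermite_sobolev_spread_poly[OF e] by auto
  next
    case True
    define i where "i = (j - e) div 2"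
    have ji: "j = 2 * i + e" using True e by (cases e; auto simp: i_def elim!: oddE evenE)
    have "i < n" using j ji by simp
    have "gauss_moment (2 * m + e + j) = ?s * pochhammer ?a (m + i)" for m
    proof -
      have "2 * m + e + j = 2 * (e + (m + i))" using ji by simp
      then show ?thesis by (simp add: gauss_moment_def pochhammer_product'[of _ e "m + i"])
    qed
    then have "(\<Sum>m\<le>n. w m * gauss_moment (2 * m + e + j)) = ?s * (\<Sum>m\<le>n. w m * pochhammer ?a (m + i))"
      by (simp add: sum_distrib_left algebra_simps)
    also have "\<dots> = (if i = 0 then - mass_ratio e M n * (?s * kernel_norm ?a n) else 0)"
      unfolding w_def using \<open>i < n\<close> by (subst laguerre_coeff_orthogonal) auto
    finally have "hermite_sobolev M0 M1 (spread_poly e w n) (monom 1 j)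
      = (if i = 0 then - mass_ratio e M n * (?s * kernel_norm ?a n) + M * w 0 else 0)"
      using hermite_sobolev_spread_poly[OF e, of M0 M1 w n j] True ji by (simp add: M_def)
    also have "\<dots> = (if i = 0 then M - mass_ratio e M n * (M + ?s * kernel_norm ?a n) else 0)"
      by (simp add: w0 algebra_simps)
    also have "\<dots> = 0" using denom by (simp add: mass_ratio_def)
    finally show ?thesis .
  qed
  show "Q (2 * n + e) = smult (1 / w n) (spread_poly e w n)"
    using monic_orthogonal_unique[OF assms(1,2) Q, of "2 * n + e" "spread_poly e w n"]
      coeff_spread_poly_above coeff_spread_poly_top wn orth by simp
qed

section \<open>The scaling limit\<close>

lemma binomial_over_power_le: "real (n choose m) / real n ^ m \<le> 1 / fact m"
proof (cases "real n ^ m = 0")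
  case False
  have "real ((n choose m) * fact m) \<le> real (n ^ m)"
    using binomial_fact_pow[of n m] by (simp only: of_nat_le_iff)
  moreover have "real n ^ m > 0" using False zero_le_power[of "real n" m] by linarith
  ultimately show ?thesis by (simp add: divide_simps)
qed (auto simp: power_0_left)

lemma binomial_over_power_tendsto: "(\<lambda>n. real (n choose m) / real n ^ m) \<longlonglongrightarrow> 1 / fact m"
proof (induction m)
  case (Suc m)
  have eq: "real (n choose m) / real n ^ m * (1 - real m / real n) / real (Suc m)
      = real (n choose Suc m) / real n ^ Suc m" if "0 < n" for n
  proof -
    have "real (Suc m) * real (n choose Suc m) = (real n - real m) * real (n choose m)"
    proof (cases "m \<le> n")
      case True
      have "real (Suc m * (n choose Suc m)) = real ((n - m) * (n choose m))"
        by (simp only: binomial_absorption binomial_absorb_comp)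
      then show ?thesis using True by (simp only: of_nat_mult of_nat_diff)
    qed (simp add: binomial_eq_0)
    then have rec: "real (n choose Suc m) = (real n - real m) * real (n choose m) / real (Suc m)"
      by (simp add: field_simps del: of_nat_Suc)
    show ?thesis unfolding rec using that by (simp add: field_simps del: of_nat_Suc)
  qed
  have "(\<lambda>n. real (n choose m) / real n ^ m * (1 - real m / real n) / real (Suc m))
      \<longlonglongrightarrow> 1 / fact m * (1 - 0) / real (Suc m)"
    by (intro tendsto_intros Suc.IH real_tendsto_divide_at_top filterlim_real_sequentially) auto
  then have "(\<lambda>n. real (n choose Suc m) / real n ^ Suc m) \<longlonglongrightarrow> 1 / fact m * (1 - 0) / real (Suc m)"
    by (rule Lim_transform_eventually) (use eq in \<open>auto intro: eventually_mono[OF eventually_gt_at_top[of 0]]\<close>)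
  then show ?case by (simp add: fact_Suc field_simps del: of_nat_Suc)
qed simp

lemma pred_binomial_over_power_tendsto:
  "(\<lambda>n. real (n - 1 choose m) / real n ^ m) \<longlonglongrightarrow> 1 / fact m"
proof -
  have eq: "real (n choose m) / real n ^ m * (1 - real m / real n) = real (n - 1 choose m) / real n ^ m"
    if n: "0 < n" for n
  proof -
    have "real n * real (n - 1 choose m) = (real n - real m) * real (n choose m)"
    proof (cases "m \<le> n")
      case True
      have "real ((n - m) * (n choose m)) = real (n * (n - 1 choose m))"
        by (simp only: binomial_absorb_comp)
      then show ?thesis using True by (simp only: of_nat_mult of_nat_diff)
    qed (use n in \<open>simp add: binomial_eq_0\<close>)
    then have rec: "real (n - 1 choose m) = (real n - real m) * real (n choose m) / real n"
      using n by (simp add: field_simps)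
    show ?thesis unfolding rec using n by (simp add: field_simps)
  qed
  have "(\<lambda>n. real (n choose m) / real n ^ m * (1 - real m / real n)) \<longlonglongrightarrow> 1 / fact m * (1 - 0)"
    by (intro tendsto_intros binomial_over_power_tendsto real_tendsto_divide_at_top
        filterlim_real_sequentially)
  then have "(\<lambda>n. real (n - 1 choose m) / real n ^ m) \<longlonglongrightarrow> 1 / fact m * (1 - 0)"
    by (rule Lim_transform_eventually) (use eq in \<open>auto intro: eventually_mono[OF eventually_gt_at_top[of 0]]\<close>)
  then show ?thesis by simp
qed

definition scaled_coeff :: "real \<Rightarrow> (nat \<Rightarrow> real) \<Rightarrow> nat \<Rightarrow> nat \<Rightarrow> real" where
  "scaled_coeff a \<theta> n m = laguerre_coeff a (\<theta> n) n m / real n ^ m"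

lemma scaled_coeff_bound:
  assumes a: "0 < a" and \<theta>: "\<And>n. \<bar>\<theta> n\<bar> \<le> 1"
  shows "\<bar>scaled_coeff a \<theta> n m\<bar> \<le> (2 / min a 1) / fact m"
proof -
  have le: "\<bar>real (k choose m) / real n ^ m / pochhammer b m\<bar> \<le> 1 / fact m / min a 1"
    if "a \<le> b" "k \<le> n" for b k
  proof -
    have "real (k choose m) / real n ^ m \<le> real (n choose m) / real n ^ m"
      using binomial_right_mono[of k n m] that by (intro divide_right_mono) auto
    also have "\<dots> \<le> 1 / fact m" by (rule binomial_over_power_le)
    finally have "real (k choose m) / real n ^ m \<le> 1 / fact m" .
    moreover have "min a 1 \<le> pochhammer b m" using pochhammer_ge_min[of b m] a that by auto
    ultimately have "real (k choose m) / real n ^ m / pochhammer b m \<le> 1 / fact m / min a 1"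
      by - (rule frac_le, use a in auto)
    moreover have "pochhammer b m > 0" using a that by (intro pochhammer_pos) auto
    ultimately show ?thesis by simp
  qed
  define A where "A = real (n choose m) / real n ^ m / pochhammer a m"
  define B where "B = real (n - 1 choose m) / real n ^ m / pochhammer (a + 1) m"
  have A: "\<bar>A\<bar> \<le> 1 / fact m / min a 1" unfolding A_def by (rule le) auto
  have B: "\<bar>B\<bar> \<le> 1 / fact m / min a 1" unfolding B_def by (rule le) auto
  have "\<bar>\<theta> n * B\<bar> \<le> 1 * \<bar>B\<bar>" unfolding abs_mult by (intro mult_right_mono \<theta>) simp
  then have "\<bar>A - \<theta> n * B\<bar> \<le> 1 / fact m / min a 1 + 1 / fact m / min a 1"
    using A B abs_triangle_ineq4[of A "\<theta> n * B"] by linarith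
  also have "1 / f / r + 1 / f / r = (2 / r) / f" for f r :: real
    by (cases "f = 0"; cases "r = 0") (simp_all add: field_simps)
  finally have le_AB: "\<bar>A - \<theta> n * B\<bar> \<le> (2 / min a 1) / fact m" .
  have eq: "scaled_coeff a \<theta> n m = (-1) ^ m * (A - \<theta> n * B)"
    by (simp add: scaled_coeff_def laguerre_coeff_def A_def B_def diff_divide_distrib algebra_simps)
  have "\<bar>scaled_coeff a \<theta> n m\<bar> = \<bar>A - \<theta> n * B\<bar>" unfolding eq by (simp add: abs_mult)
  then show ?thesis using le_AB by (rule ord_eq_le_trans)
qed

lemma scaled_coeff_tendsto:
  assumes "\<theta> \<longlonglongrightarrow> \<theta>'" "0 < a"
  shows "(\<lambda>n. scaled_coeff a \<theta> n m) \<longlonglongrightarrow> bessel_series_coeff a m - \<theta>' * bessel_series_coeff (a + 1) m"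
proof -
  have "pochhammer a m > 0" "pochhammer (a + 1) m > 0" using assms(2) by (auto intro!: pochhammer_pos)
  then have "(\<lambda>n. (-1) ^ m * (real (n choose m) / real n ^ m / pochhammer a m
        - \<theta> n * (real (n - 1 choose m) / real n ^ m / pochhammer (a + 1) m)))
      \<longlonglongrightarrow> (-1) ^ m * (1 / fact m / pochhammer a m - \<theta>' * (1 / fact m / pochhammer (a + 1) m))"
    by (intro tendsto_intros assms binomial_over_power_tendsto pred_binomial_over_power_tendsto) auto
  then show ?thesis
    by (simp add: scaled_coeff_def laguerre_coeff_def bessel_series_coeff_def diff_divide_distrib algebra_simps)
qed

lemma mass_ratio_bounds:
  assumes "0 \<le> M" shows "0 \<le> mass_ratio e M n" "mass_ratio e M n < 1"
proof -
  have "sqrt pi * pochhammer (1/2) e * kernel_norm (1/2 + real e) n > 0"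
    by (intro mult_pos_pos kernel_norm_pos pochhammer_pos) auto
  then show "0 \<le> mass_ratio e M n" "mass_ratio e M n < 1"
    using assms by (auto simp: mass_ratio_def)
qed

lemma mass_ratio_tendsto: "mass_ratio e M \<longlonglongrightarrow> (if M = 0 then 0 else 1)"
proof (cases "M = 0")
  case False
  have "(\<lambda>n. M / (M + sqrt pi * pochhammer (1/2) e * kernel_norm (1/2 + real e) n))
      \<longlonglongrightarrow> M / (M + sqrt pi * pochhammer (1/2) e * 0)"
    using False by (intro tendsto_intros kernel_norm_tendsto_0) auto
  then show ?thesis using False by (simp add: mass_ratio_def[abs_def])
qed (simp add: mass_ratio_def[abs_def])

text \<open>
  The limit of the rescaled polynomials. It jumps between \<open>M = 0\<close> and \<open>M > 0\<close> because the limit of \<open>\<theta>\<close> does.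
\<close>

definition limit_series :: "real \<Rightarrow> real \<Rightarrow> real \<Rightarrow> real" where
  "limit_series a M t = bessel_series a t - (if M = 0 then 0 else 1) * bessel_series (a + 1) t"

text \<open>
  With a mass the limit is \<open>t B_{a+2}(t)\<close> up to a constant factor, and \<open>B_{a+2}\<close> does not vanish at 0.
\<close>

lemma limit_series_simple_zeros:
  assumes a: "0 < a" and der: "(limit_series a M has_real_derivative D) (at t)"
    and t: "0 \<le> t" and zero: "limit_series a M t = 0"
  shows "D \<noteq> 0"
proof (cases "M = 0")
  case True
  then have "limit_series a M = bessel_series a" by (simp add: limit_series_def fun_eq_iff)
  then have "D = - (1 / a) * bessel_series (a + 1) t" and "bessel_series a t = 0"
    using DERIV_unique[OF der[unfolded \<open>limit_series a M = bessel_series a\<close>] bessel_series_has_real_derivative[OF a]] zero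
    by auto
  then show ?thesis using bessel_series_no_common_zero[OF a t] a by simp
next
  case False
  let ?c = "1 / (a * (a + 1))"
  have eq: "limit_series a M = (\<lambda>t. - ?c * (t * bessel_series (a + 2) t))"
    using False bessel_series_contiguous[OF a] by (simp add: limit_series_def fun_eq_iff)
  have "((\<lambda>t. - ?c * (t * bessel_series (a + 2) t)) has_real_derivative
      - ?c * (bessel_series (a + 2) t + t * (- (1 / (a + 2)) * bessel_series (a + 2 + 1) t))) (at t)"
    using a by (auto intro!: derivative_eq_intros bessel_series_has_real_derivative[of "a + 2"])
  then have D: "D = - ?c * (bessel_series (a + 2) t + t * (- (1 / (a + 2)) * bessel_series (a + 2 + 1) t))"
    using der DERIV_unique unfolding eq by blast
  show ?thesis
  proof (cases "t = 0")
    case True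
    then show ?thesis using a D by simp
  next
    case False
    then have "bessel_series (a + 2) t = 0" using zero a unfolding eq by simp
    then show ?thesis using bessel_series_no_common_zero[of "a + 2" t] a t False D by simp
  qed
qed

text \<open>
  The \<open>k\<close>-th positive zero of \<open>Q (2 n + e)\<close> is \<open>\<surd>(t / n)\<close> for the \<open>k\<close>-th positive zero \<open>t\<close> of the rescaled
  polynomial, which converges to the \<open>k\<close>-th nonnegative zero of the limit.
\<close>

lemma positive_root_tendsto:
  fixes M0 M1 :: real and Q :: "nat \<Rightarrow> real poly" and e :: nat
  assumes M: "M0 \<ge> 0" "M1 \<ge> 0" and Q: "monic_orthogonal (hermite_sobolev M0 M1) Q"
    and e: "e \<le> 1"
    and kth: "is_kth {t. 0 \<le> t \<and> limit_series (1/2 + real e) (if e = 0 then M0 else M1) t = 0} k s"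
  shows "(\<lambda>n. sqrt (real n) * positive_root (Q (2 * n + e)) k) \<longlonglongrightarrow> sqrt s"
proof -
  define a where "a = 1/2 + real e"
  define Me where "Me = (if e = 0 then M0 else M1)"
  define \<theta>' :: real where "\<theta>' = (if Me = 0 then 0 else 1)"
  define c where "c = scaled_coeff a (mass_ratio e Me)"
  define d where "d m = bessel_series_coeff a m - \<theta>' * bessel_series_coeff (a + 1) m" for m
  define F where "F n t = (\<Sum>m. c n m * t ^ m)" for n t
  have a: "0 < a" by (simp add: a_def)
  have Me: "0 \<le> Me" using M by (simp add: Me_def)
  have bound: "\<bar>c n m\<bar> \<le> (2 / min a 1) / fact m" for n m
    unfolding c_def using mass_ratio_bounds[OF Me]
    by (intro scaled_coeff_bound a) (simp add: abs_le_iff less_imp_le add_increasing)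
  have lim: "(\<lambda>n. c n m) \<longlonglongrightarrow> d m" for m
    unfolding c_def d_def \<theta>'_def by (intro scaled_coeff_tendsto mass_ratio_tendsto a)
  note bound_d = limit_exp_bounded[OF bound lim]
  have f_eq: "limit_series a Me = (\<lambda>t. \<Sum>m. d m * t ^ m)"
  proof
    fix t
    have "limit_series a Me t = (\<Sum>m. bessel_series_coeff a m * t ^ m) - (\<Sum>m. \<theta>' * (bessel_series_coeff (a + 1) m * t ^ m))"
      using suminf_mult[OF summable_bessel_series[of "a + 1" t], of \<theta>'] a
      by (simp add: limit_series_def bessel_series_def \<theta>'_def)
    also have "\<dots> = (\<Sum>m. bessel_series_coeff a m * t ^ m - \<theta>' * (bessel_series_coeff (a + 1) m * t ^ m))"
      using a by (intro suminf_diff summable_mult summable_bessel_series) auto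
    finally show "limit_series a Me t = (\<Sum>m. d m * t ^ m)" by (simp add: d_def algebra_simps)
  qed
  have der_f: "(limit_series a Me has_real_derivative (\<Sum>m. diffs d m * t ^ m)) (at t)" for t
    unfolding f_eq by (rule powser_has_real_derivative[OF bound_d])
  interpret zero_convergence "limit_series a Me" "\<lambda>t. \<Sum>m. diffs d m * t ^ m" F
    "\<lambda>n t. \<Sum>m. diffs (c n) m * t ^ m"
  proof
    show "(F n has_real_derivative (\<Sum>m. diffs (c n) m * t ^ m)) (at t)" for n t
      unfolding F_def by (rule powser_has_real_derivative[OF bound])
    show "(limit_series a Me has_real_derivative (\<Sum>m. diffs d m * t ^ m)) (at t)" for t
      by (rule der_f)
    show "continuous_on UNIV (\<lambda>t. \<Sum>m. diffs d m * t ^ m)"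
      using powser_has_real_derivative[OF diffs_exp_bounded[OF bound_d]] DERIV_isCont
      by (intro continuous_at_imp_continuous_on) blast
    show "uniform_limit {0..T} F (limit_series a Me) sequentially" for T
      unfolding F_def f_eq by (rule uniform_limit_powser[OF bound lim])
    show "uniform_limit {0..T} (\<lambda>n t. \<Sum>m. diffs (c n) m * t ^ m) (\<lambda>t. \<Sum>m. diffs d m * t ^ m)
        sequentially" for T
    proof (rule uniform_limit_powser[OF diffs_exp_bounded[OF bound]])
      show "(\<lambda>n. diffs (c n) m) \<longlonglongrightarrow> diffs d m" for m
        unfolding diffs_def by (intro tendsto_intros lim)
    qed
    show "(\<Sum>m. diffs d m * t ^ m) \<noteq> 0" if "0 \<le> t" "limit_series a Me t = 0" for t
      by (rule limit_series_simple_zeros[OF a der_f that])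
    \<comment> \<open>The value \<open>1 - \<theta>\<close> at the origin is positive and the limit decreases there, so the zero near 0 is positive.\<close>
    show "\<forall>\<^sub>F n in sequentially. (\<Sum>m. diffs d m * 0 ^ m) * F n 0 < 0" if "limit_series a Me 0 = 0"
    proof -
      have "\<theta>' = 1" using that by (simp add: limit_series_def \<theta>'_def split: if_splits)
      then have "(\<Sum>m. diffs d m * 0 ^ m) = 1 / (a + 1) - 1 / a"
        by (simp add: diffs_def d_def bessel_series_coeff_def)
      also have "\<dots> < 0" using a by (simp add: frac_less2)
      finally have "(\<Sum>m. diffs d m * 0 ^ m) < 0" .
      moreover have "F n 0 > 0" for n
        using mass_ratio_bounds(2)[OF Me, of e n] powser_zero[of "c n"]
        by (simp add: F_def c_def scaled_coeff_def laguerre_coeff_def)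
      ultimately show ?thesis by (intro always_eventually allI mult_neg_pos)
    qed
  qed
  have root: "sqrt (real n) * positive_root (Q (2 * n + e)) k = sqrt (kth_least {t. 0 < t \<and> F n t = 0} k)"
    if n: "0 < n" and ex: "\<exists>z. is_kth {t. 0 < t \<and> F n t = 0} k z" for n
  proof -
    define w where "w = laguerre_coeff a (mass_ratio e Me n) n"
    have w: "w n \<noteq> 0" "Q (2 * n + e) = smult (1 / w n) (spread_poly e w n)"
      using sobolev_polynomial_eq[OF M Q e n] unfolding w_def a_def Me_def by auto
    have F: "F n t = (\<Sum>m\<le>n. w m * (t / real n) ^ m)" for t
    proof -
      have "c n m = 0" if "m \<notin> {..n}" for m
        using that by (simp add: c_def scaled_coeff_def laguerre_coeff_def binomial_eq_0)
      then have "F n t = (\<Sum>m\<le>n. c n m * t ^ m)" unfolding F_def by (intro suminf_finite) auto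
      then show ?thesis by (simp add: c_def scaled_coeff_def w_def power_divide)
    qed
    let ?S = "{t. 0 < t \<and> F n t = 0}"
    let ?h = "\<lambda>t. sqrt (t / real n)"
    have zero_iff: "poly (Q (2 * n + e)) x = 0 \<longleftrightarrow> F n (real n * x\<^sup>2) = 0" if "0 < x" for x
      using n w that by (simp add: F poly_spread_poly)
    have img: "?h ` ?S = {x. 0 < x \<and> poly (Q (2 * n + e)) x = 0}"
    proof (intro equalityI subsetI)
      fix x assume "x \<in> ?h ` ?S"
      then obtain t where "0 < t" "F n t = 0" "x = ?h t" by auto
      then show "x \<in> {x. 0 < x \<and> poly (Q (2 * n + e)) x = 0}" using n zero_iff[of x] by simp
    next
      fix x assume "x \<in> {x. 0 < x \<and> poly (Q (2 * n + e)) x = 0}"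
      then show "x \<in> ?h ` ?S" using n zero_iff[of x]
        by (intro image_eqI[of _ _ "real n * x\<^sup>2"]) auto
    qed
    obtain z where z: "is_kth ?S k z" using ex by blast
    have "strict_mono_on ?S ?h" using n by (intro strict_mono_onI) (simp add: divide_strict_right_mono)
    from is_kth_image[OF z this]
    have "is_kth {x. 0 < x \<and> poly (Q (2 * n + e)) x = 0} k (?h z)" unfolding img .
    then have "positive_root (Q (2 * n + e)) k = ?h z"
      unfolding positive_root_def by (rule kth_least_eq)
    then show ?thesis using kth_least_eq[OF z] n by (simp add: real_sqrt_divide)
  qed
  have kth': "is_kth {t. 0 \<le> t \<and> limit_series a Me t = 0} k s" using kth by (simp add: a_def Me_def)
  have "(\<lambda>n. sqrt (kth_least {t. 0 < t \<and> F n t = 0} k)) \<longlonglongrightarrow> sqrt s"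
    by (intro tendsto_real_sqrt kth_zero_tendsto(1)[OF kth'])
  moreover have "\<forall>\<^sub>F n in sequentially.
      sqrt (kth_least {t. 0 < t \<and> F n t = 0} k) = sqrt (real n) * positive_root (Q (2 * n + e)) k"
    using kth_zero_tendsto(2)[OF kth'] eventually_gt_at_top[of 0]
    by eventually_elim (rule root[symmetric])
  ultimately show ?thesis by (rule Lim_transform_eventually)
qed

lemma positive_root_tendsto_no_mass:
  assumes M: "M0 \<ge> 0" "M1 \<ge> 0" "(if e = 0 then M0 else M1) = 0"
    and Q: "monic_orthogonal (hermite_sobolev M0 M1) Q" and e: "e \<le> 1" and k: "1 \<le> k"
  shows "(\<lambda>n. 2 * sqrt (real n) * positive_root (Q (2 * n + e)) k)
    \<longlonglongrightarrow> bessel_zero (real e - 1/2) k"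
proof -
  obtain s where s: "is_kth {t. 0 < t \<and> bessel_series (1/2 + real e) t = 0} k s"
    "bessel_zero (real e - 1/2) k = 2 * sqrt s"
    using bessel_series_kth_zero[of e "k - 1"] k by auto
  have "{t. 0 \<le> t \<and> limit_series (1/2 + real e) 0 t = 0} = {t. 0 < t \<and> bessel_series (1/2 + real e) t = 0}"
    using bessel_series_0[of "1/2 + real e"] unfolding limit_series_def
    by (auto simp del: bessel_series_0 simp: order_le_less)
  then have "(\<lambda>n. sqrt (real n) * positive_root (Q (2 * n + e)) k) \<longlonglongrightarrow> sqrt s"
    using s(1) M by (intro positive_root_tendsto[OF M(1,2) Q e]) simp
  from tendsto_mult_left[OF this, of 2] show ?thesis by (simp add: s(2) mult.assoc)
qed

text \<open>
  The origin is now the first nonnegative zero of the limit, which shifts the numbering of the Bessel zeros by one.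
\<close>

lemma positive_root_tendsto_mass:
  assumes M: "M0 \<ge> 0" "M1 \<ge> 0" "(if e = 0 then M0 else M1) > 0"
    and Q: "monic_orthogonal (hermite_sobolev M0 M1) Q" and e: "e \<le> 1"
  shows "(\<lambda>n. sqrt (real n) * positive_root (Q (2 * n + e)) 1) \<longlonglongrightarrow> 0"
    and "2 \<le> k \<Longrightarrow> (\<lambda>n. 2 * sqrt (real n) * positive_root (Q (2 * n + e)) k)
      \<longlonglongrightarrow> bessel_zero (real e + 3/2) (k - 1)"
proof -
  let ?a = "1/2 + real e"
  let ?M = "if e = 0 then M0 else M1"
  let ?Z = "{t. 0 \<le> t \<and> limit_series ?a ?M t = 0}"
  let ?S = "{t. 0 < t \<and> bessel_series (1/2 + real (e + 2)) t = 0}"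
  have eq: "limit_series ?a ?M t = - t / (?a * (?a + 1)) * bessel_series (1/2 + real (e + 2)) t" for t
    using M(3) bessel_series_contiguous[of ?a t] by (simp add: limit_series_def algebra_simps)
  have "?a * (?a + 1) \<noteq> 0" by (simp add: add_nonneg_eq_0_iff)
  then have "limit_series ?a ?M t = 0 \<longleftrightarrow> t = 0 \<or> bessel_series (1/2 + real (e + 2)) t = 0" for t
    unfolding eq by simp
  then have Z: "?Z = insert 0 ?S" by auto
  have "{y \<in> ?Z. y \<le> 0} = {0}" unfolding Z by auto
  then have "is_kth ?Z 1 0" unfolding is_kth_def by (simp add: Z)
  from positive_root_tendsto[OF M(1,2) Q e this]
  show "(\<lambda>n. sqrt (real n) * positive_root (Q (2 * n + e)) 1) \<longlonglongrightarrow> 0" by simp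
  assume k: "2 \<le> k"
  obtain s where s: "is_kth ?S (k - 1) s" "bessel_zero (real (e + 2) - 1/2) (k - 1) = 2 * sqrt s"
    using bessel_series_kth_zero[of "e + 2" "k - 2"] k by (metis Suc_diff_Suc Suc_1 diff_Suc_1 less_eq_Suc_le numeral_2_eq_2)
  have "0 < s" using s(1) by (simp add: is_kth_def)
  then have "{y \<in> ?Z. y \<le> s} = insert 0 {y \<in> ?S. y \<le> s}" unfolding Z by auto
  moreover have "0 \<notin> {y \<in> ?S. y \<le> s}" by simp
  ultimately have "is_kth ?Z k s"
    using s(1) k unfolding is_kth_def Z by (simp del: Collect_conj_eq)
  from tendsto_mult_left[OF positive_root_tendsto[OF M(1,2) Q e this], of 2]
  show "(\<lambda>n. 2 * sqrt (real n) * positive_root (Q (2 * n + e)) k)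
      \<longlonglongrightarrow> bessel_zero (real e + 3/2) (k - 1)"
    using s(2) by (simp add: mult.assoc add.commute[of "real e"])
qed

theorem corollary1:
  fixes M0 M1 :: real and Q :: "nat \<Rightarrow> real poly"
  assumes "M0 \<ge> 0" and "M1 \<ge> 0"
    and "monic_orthogonal (hermite_sobolev M0 M1) Q"
  shows
    "(M0 = 0 \<longrightarrow>
        (\<forall>k\<ge>1. (\<lambda>n. 2 * sqrt (real n) * positive_root (Q (2 * n)) k)
                  \<longlonglongrightarrow> bessel_zero (-1/2) k)) \<and>
     (M0 > 0 \<longrightarrow>
        ((\<lambda>n. sqrt (real n) * positive_root (Q (2 * n)) 1) \<longlonglongrightarrow> 0) \<and>
        (\<forall>k\<ge>2. (\<lambda>n. 2 * sqrt (real n) * positive_root (Q (2 * n)) k)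
                  \<longlonglongrightarrow> bessel_zero (3/2) (k - 1))) \<and>
     (M1 = 0 \<longrightarrow>
        (\<forall>k\<ge>1. (\<lambda>n. 2 * sqrt (real n) * positive_root (Q (2 * n + 1)) k)
                  \<longlonglongrightarrow> bessel_zero (1/2) k)) \<and>
     (M1 > 0 \<longrightarrow>
        ((\<lambda>n. sqrt (real n) * positive_root (Q (2 * n + 1)) 1) \<longlonglongrightarrow> 0) \<and>
        (\<forall>k\<ge>2. (\<lambda>n. 2 * sqrt (real n) * positive_root (Q (2 * n + 1)) k)
                  \<longlonglongrightarrow> bessel_zero (5/2) (k - 1)))"
proof (intro conjI impI allI)
  note no_mass = positive_root_tendsto_no_mass[OF assms(1,2) _ assms(3)]
  note mass = positive_root_tendsto_mass[OF assms(1,2) _ assms(3)]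
  show "(\<lambda>n. 2 * sqrt (real n) * positive_root (Q (2 * n)) k) \<longlonglongrightarrow> bessel_zero (-1/2) k"
    if "M0 = 0" "1 \<le> k" for k
    using no_mass[of 0 k] that by simp
  show "(\<lambda>n. sqrt (real n) * positive_root (Q (2 * n)) 1) \<longlonglongrightarrow> 0" if "M0 > 0"
    using mass(1)[of 0] that by simp
  show "(\<lambda>n. 2 * sqrt (real n) * positive_root (Q (2 * n)) k) \<longlonglongrightarrow> bessel_zero (3/2) (k - 1)"
    if "M0 > 0" "2 \<le> k" for k
    using mass(2)[of 0 k] that by simp
  show "(\<lambda>n. 2 * sqrt (real n) * positive_root (Q (2 * n + 1)) k) \<longlonglongrightarrow> bessel_zero (1/2) k"
    if "M1 = 0" "1 \<le> k" for k
    using no_mass[of 1 k] that by simp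
  show "(\<lambda>n. sqrt (real n) * positive_root (Q (2 * n + 1)) 1) \<longlonglongrightarrow> 0" if "M1 > 0"
    using mass(1)[of 1] that by simp
  show "(\<lambda>n. 2 * sqrt (real n) * positive_root (Q (2 * n + 1)) k) \<longlonglongrightarrow> bessel_zero (5/2) (k - 1)"
    if "M1 > 0" "2 \<le> k" for k
    using mass(2)[of 1 k] that by simp
qed

end
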